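(* Let $v\in[0,1]$. Then $$\mathrm{m}\left(v(1+x)+y+z\right)=\frac{2}{\pi}\int_0^v\frac{\sin^{-1}(u)}{u}\,du-\frac{4}{\pi^2}\mathrm{S}(v,1)=\frac{4}{\pi^2}\left(\frac{\mathrm{Li}_3(v)-\mathrm{Li}_3(-v)}{2}\right).$$
   Context: For a nonzero Laurent polynomial $P$ in $n$ variables, its (logarithmic) Mahler measure is $\mathrm{m}(P)=\int_0^1\cdots\int_0^1\log|P(e^{2\pi i\theta_1},\dots,e^{2\pi i\theta_n})|\,d\theta_1\cdots d\theta_n$; here the variables are $x,y,z$. The function $\mathrm{S}$ is $\mathrm{S}(v,w)=\int_0^1\frac{\sin^{-1}(vx)\sin^{-1}(wx)}{x}\,dx$, and $\mathrm{Li}_3(z)=\sum_{n\ge1}z^n/n^3$ for $|z|\le1$. *)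

theory Defs
  imports "HOL-Analysis.Analysis" "HOL-Library.Poly_Mapping"
begin

text \<open>
  Laurent polynomials in the variables indexed by the finite type \<open>'n\<close>, i.e. the monoid algebra
  over \<open>\<complex>\<close> of the group of exponent vectors.  The ring operations are those of \<open>Poly_Mapping\<close>
  (multiplication is convolution).
\<close>

type_synonym 'n laurent = "(int ^ 'n) \<Rightarrow>\<^sub>0 complex"

definition laurent_const :: "complex \<Rightarrow> 'n::finite laurent" where
  "laurent_const c = Poly_Mapping.single 0 c"

definition laurent_var :: "'n \<Rightarrow> 'n::finite laurent" where
  "laurent_var i = Poly_Mapping.single (axis i 1) 1"

definition laurent_eval :: "'n::finite laurent \<Rightarrow> complex ^ 'n \<Rightarrow> complex" where
  "laurent_eval P t =
     (\<Sum>k\<in>Poly_Mapping.keys P. Poly_Mapping.lookup P k * (\<Prod>i\<in>UNIV. (t $ i) powi (k $ i)))"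

text \<open>
  The iterated integral is the Lebesgue integral over the unit cube; here \<open>1 :: real ^ 'n\<close> is the
  all-ones vector.  For nonzero \<open>P\<close> the integrand is integrable, and the zero set of \<open>P\<close> on the
  torus, where \<open>ln 0 = 0\<close> in HOL, is null.
\<close>

definition mahler_measure :: "'n::finite laurent \<Rightarrow> real" where
  "mahler_measure P =
     (LBINT \<theta>:cbox 0 (1 :: real ^ 'n).
        ln (cmod (laurent_eval P (\<chi> i. exp (2 * of_real pi * \<i> * of_real (\<theta> $ i))))))"

definition S_fun :: "real \<Rightarrow> real \<Rightarrow> real" where
  "S_fun v w = (LBINT x=0..1. arcsin (v * x) * arcsin (w * x) / x)"

text \<open>The trilogarithm on the closed unit disc.\<close>

definition Li3 :: "'a::{real_normed_field,banach} \<Rightarrow> 'a" where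
  "Li3 z = suminf (\<lambda>n. z ^ Suc n / of_nat (Suc n) ^ 3)"

end

theory Submission
  imports Defs "HOL-Complex_Analysis.Complex_Analysis" "HOL-Real_Asymp.Real_Asymp"
begin

text \<open>
  Rotating \<open>z\<close> by \<open>y\<close> replaces \<open>v(1+x)+y+z\<close> by \<open>v(1+x)+y(1+z)\<close>, and Jensen's formula in \<open>y\<close> turns the
  Mahler measure into the mean of \<open>ln max(2 v C, 2 D)\<close> with \<open>C = |1+x|/2\<close> and \<open>D = |1+z|/2\<close>.  As
  \<open>ln (2 D)\<close> has mean zero, this is the mean of \<open>ln\<^sup>+ (v C / D)\<close>.  Writing it as the integral of \<open>1/u\<close>
  over \<open>D/v < u < C\<close> and using the arcsine law for \<open>C\<close> and \<open>D\<close> gives \<open>4/\<pi>\<^sup>2\<close> times the integral of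
  \<open>arcsin(v u) arccos(u) / u\<close> over \<open>[0,1]\<close>.  Replacing \<open>arccos\<close> by \<open>\<pi>/2 - arcsin\<close> yields the first formula, expanding \<open>arcsin\<close> in its power series the second.
  All integrals are computed as nonnegative integrals (of \<open>ln 4 - ln |P|\<close>), so that Tonelli applies and
  integrability comes for free; Jensen's formula is then needed only off the null set \<open>v C = D\<close>.
\<close>

subsection \<open>Laurent polynomials and integrals over the cube\<close>

text \<open>Exponents outside the support have coefficient zero. This freedom lets \<open>P\<close>,
  \<open>Q\<close> and \<open>P + Q\<close>, whose supports differ, be summed over one common index
  set.\<close>

lemma laurent_eval_superset:
  assumes "finite S" "Poly_Mapping.keys P \<subseteq> S"
  shows "laurent_eval P t = (\<Sum>k\<in>S. Poly_Mapping.lookup P k * (\<Prod>i\<in>UNIV. (t $ i) powi (k $ i)))"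
  unfolding laurent_eval_def
  by (rule sum.mono_neutral_left) (use assms in \<open>auto simp: in_keys_iff\<close>)

lemma laurent_eval_add: "laurent_eval (P + Q) t = laurent_eval P t + laurent_eval Q t"
proof -
  let ?S = "Poly_Mapping.keys P \<union> Poly_Mapping.keys Q"
  have "laurent_eval R t = (\<Sum>k\<in>?S. Poly_Mapping.lookup R k * (\<Prod>i\<in>UNIV. (t $ i) powi (k $ i)))"
    if "R \<in> {P, Q, P + Q}" for R
    by (rule laurent_eval_superset) (use that keys_add[of P Q] in auto)
  then show ?thesis
    by (simp add: lookup_add distrib_right sum.distrib)
qed

lemma laurent_eval_single:
  "laurent_eval (Poly_Mapping.single k c) t = c * (\<Prod>i\<in>UNIV. (t $ i) powi (k $ i))"
  by (subst laurent_eval_superset[of "{k}"]) auto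

lemma prod_powi_axis:
  fixes t :: "complex ^ 'n::finite"
  shows "(\<Prod>i\<in>UNIV. (t $ i) powi (axis j 1 $ i)) = t $ j"
proof -
  have "(\<Prod>i\<in>UNIV. (t $ i) powi (axis j 1 $ i)) = (\<Prod>i\<in>UNIV. if i = j then t $ j else 1)"
    by (rule prod.cong) (auto simp: axis_def)
  then show ?thesis by simp
qed

text \<open>The only product in the form has a constant factor. Expanding it into two monomials
  inside the algebra makes additivity of evaluation sufficient.\<close>

lemma laurent_eval_linear_form:
  fixes t :: "complex ^ 3"
  shows "laurent_eval (laurent_const c * (1 + laurent_var 1) + laurent_var 2 + laurent_var 3) t
    = c * (1 + t $ 1) + t $ 2 + t $ 3"
proof -
  have "laurent_const c * (1 + laurent_var 1)
      = (Poly_Mapping.single 0 c + Poly_Mapping.single (axis 1 1) c :: 3 laurent)"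
    by (simp add: laurent_const_def laurent_var_def distrib_left mult_single)
  then show ?thesis
    by (simp add: laurent_eval_add laurent_eval_single laurent_var_def prod_powi_axis distrib_left)
qed

section \<open>Lebesgue measure on three-space as an iterated product\<close>

lemma borel_measurable_vec3:
  "(\<lambda>(a, b, c). vector [a, b, c] :: real ^ 3) \<in> lborel \<Otimes>\<^sub>M (lborel \<Otimes>\<^sub>M lborel) \<rightarrow>\<^sub>M borel"
proof -
  have eq: "(\<lambda>(a, b, c). vector [a, b, c] :: real ^ 3)
      = (\<lambda>p. fst p *\<^sub>R axis 1 1 + fst (snd p) *\<^sub>R axis 2 1 + snd (snd p) *\<^sub>R axis 3 1)"
    by (auto simp: vec_eq_iff forall_3 axis_def fun_eq_iff)
  have "(\<lambda>(a, b, c). vector [a, b, c] :: real ^ 3) \<in> borel_measurable borel"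
    unfolding eq by (intro borel_measurable_continuous_onI continuous_intros)
  then show ?thesis
    by (simp add: lborel_prod)
qed

text \<open>Lebesgue measure is determined by its values on open boxes, and the preimage of a box
  under the coordinate map is a product of three intervals.\<close>

lemma lborel_vec3:
  "(lborel :: (real ^ 3) measure)
    = distr (lborel \<Otimes>\<^sub>M (lborel \<Otimes>\<^sub>M lborel)) borel (\<lambda>(a, b, c). vector [a, b, c])"
proof (rule lborel_eqI)
  let ?f = "\<lambda>(a, b, c). vector [a, b, c] :: real ^ 3"
  note borel_measurable_vec3[measurable]
  fix l u :: "real ^ 3"
  assume le: "\<And>b. b \<in> Basis \<Longrightarrow> l \<bullet> b \<le> u \<bullet> b"
  have le': "l $ i \<le> u $ i" for i
    using le[of "axis i 1"] by (simp add: axis_in_Basis_iff inner_axis)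
  have "?f -` box l u \<inter> space (lborel \<Otimes>\<^sub>M (lborel \<Otimes>\<^sub>M lborel))
      = {l $ 1 <..< u $ 1} \<times> ({l $ 2 <..< u $ 2} \<times> {l $ 3 <..< u $ 3})"
    by (auto simp: space_pair_measure mem_box_cart forall_3)
  then have "emeasure (distr (lborel \<Otimes>\<^sub>M (lborel \<Otimes>\<^sub>M lborel)) borel ?f) (box l u)
      = emeasure (lborel \<Otimes>\<^sub>M (lborel \<Otimes>\<^sub>M lborel))
          ({l $ 1 <..< u $ 1} \<times> ({l $ 2 <..< u $ 2} \<times> {l $ 3 <..< u $ 3}))"
    by (simp add: emeasure_distr)
  also have "\<dots> = ennreal ((u - l) $ 1 * ((u - l) $ 2 * (u - l) $ 3))"
  proof -
    \<comment> \<open>The second factor is itself a product, so its sigma-finiteness is obtained by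
      identifying it with Lebesgue measure on pairs.\<close>
    have "sigma_finite_measure (lborel \<Otimes>\<^sub>M lborel :: (real \<times> real) measure)"
      by (simp add: lborel_prod sigma_finite_lborel)
    moreover have "{l $ 1 <..< u $ 1} \<in> sets lborel" by simp
    moreover have "{l $ 2 <..< u $ 2} \<times> {l $ 3 <..< u $ 3} \<in> sets (lborel \<Otimes>\<^sub>M lborel)"
      by (rule pair_measureI) simp_all
    ultimately have "emeasure (lborel \<Otimes>\<^sub>M (lborel \<Otimes>\<^sub>M lborel))
          ({l $ 1 <..< u $ 1} \<times> ({l $ 2 <..< u $ 2} \<times> {l $ 3 <..< u $ 3}))
        = emeasure lborel {l $ 1 <..< u $ 1}
          * emeasure (lborel \<Otimes>\<^sub>M lborel) ({l $ 2 <..< u $ 2} \<times> {l $ 3 <..< u $ 3})"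
      by (rule sigma_finite_measure.emeasure_pair_measure_Times)
    also have "emeasure (lborel \<Otimes>\<^sub>M lborel) ({l $ 2 <..< u $ 2} \<times> {l $ 3 <..< u $ 3})
        = emeasure lborel {l $ 2 <..< u $ 2} * emeasure lborel {l $ 3 <..< u $ 3}"
      by (rule lborel.emeasure_pair_measure_Times) simp_all
    finally show ?thesis
      by (simp add: le' ennreal_mult)
  qed
  also have "(u - l) $ 1 * ((u - l) $ 2 * (u - l) $ 3) = (\<Prod>i\<in>UNIV. (u - l) $ i)"
    unfolding UNIV_3 by (simp add: mult.assoc)
  also have "(\<Prod>i\<in>UNIV. (u - l) $ i) = (\<Prod>b\<in>(\<lambda>i. axis i 1) ` UNIV. (u - l) \<bullet> b)"
    by (subst prod.reindex) (auto simp: inj_on_def axis_eq_axis inner_axis)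
  also have "(\<lambda>i::3. axis i (1::real)) ` UNIV = Basis"
    by (auto simp: Basis_vec_def)
  finally show "emeasure (distr (lborel \<Otimes>\<^sub>M (lborel \<Otimes>\<^sub>M lborel)) borel ?f) (box l u)
      = (\<Prod>b\<in>Basis. (u - l) \<bullet> b)" .
qed simp

lemma nn_integral_vec3:
  fixes f :: "real ^ 3 \<Rightarrow> ennreal"
  assumes [measurable]: "f \<in> borel_measurable borel"
  shows "(\<integral>\<^sup>+x. f x \<partial>lborel)
    = (\<integral>\<^sup>+a. \<integral>\<^sup>+b. \<integral>\<^sup>+c. f (vector [a, b, c]) \<partial>lborel \<partial>lborel \<partial>lborel)"
proof -
  note borel_measurable_vec3[measurable]
  have "(\<lambda>x. f ((\<lambda>(a, b, c). vector [a, b, c]) x)) \<in> borel_measurable (lborel \<Otimes>\<^sub>M (lborel \<Otimes>\<^sub>M lborel))"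
    by measurable
  then have 1: "(\<lambda>(a, b, c). f (vector [a, b, c])) \<in> borel_measurable (lborel \<Otimes>\<^sub>M (lborel \<Otimes>\<^sub>M lborel))"
    by (simp add: case_prod_unfold)
  have 2: "(\<lambda>(b, c). f (vector [a, b, c])) \<in> borel_measurable (lborel \<Otimes>\<^sub>M lborel)" for a
    using measurable_compose[OF measurable_Pair1' 1, of a] by simp
  have "(\<integral>\<^sup>+x. f x \<partial>lborel)
      = (\<integral>\<^sup>+x. (\<lambda>(a, b, c). f (vector [a, b, c])) x \<partial>(lborel \<Otimes>\<^sub>M (lborel \<Otimes>\<^sub>M lborel)))"
    by (subst lborel_vec3, subst nn_integral_distr[OF borel_measurable_vec3]) (simp_all add: case_prod_unfold)
  also have "\<dots> = (\<integral>\<^sup>+a. \<integral>\<^sup>+x. (\<lambda>(b, c). f (vector [a, b, c])) x \<partial>(lborel \<Otimes>\<^sub>M lborel) \<partial>lborel)"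
    using 1 by (subst lborel_prod, subst lborel.nn_integral_fst[symmetric]) (simp_all add: lborel_prod)
  also have "\<dots> = (\<integral>\<^sup>+a. \<integral>\<^sup>+b. \<integral>\<^sup>+c. f (vector [a, b, c]) \<partial>lborel \<partial>lborel \<partial>lborel)"
    using 2 by (simp add: lborel.nn_integral_fst[symmetric])
  finally show ?thesis .
qed

text \<open>The shifted window \<open>{a..a+1}\<close> is cut at 1, and the piece beyond 1 is moved
  back by one period. This is what permits rotating \<open>z\<close> by \<open>y\<close>.\<close>

lemma nn_integral_periodic_shift:
  fixes G :: "real \<Rightarrow> ennreal"
  assumes [measurable]: "G \<in> borel_measurable borel" and per: "\<And>t. G (t + 1) = G t"
    and a: "0 \<le> a" "a \<le> 1"
  shows "(\<integral>\<^sup>+t\<in>{0..1}. G (a + t) \<partial>lborel) = (\<integral>\<^sup>+t\<in>{0..1}. G t \<partial>lborel)"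
proof -
  have shift: "(\<integral>\<^sup>+t. G t * indicator S t \<partial>lborel)
      = (\<integral>\<^sup>+t. G (b + t) * indicator S (b + t) \<partial>lborel)" if [measurable]: "S \<in> sets borel" for S b
    using nn_integral_real_affine[of "\<lambda>t. G t * indicator S t" 1 b] by simp
  \<comment> \<open>The reassembled pieces \<open>{0<..a}\<close> and \<open>{a..1}\<close> overlap
    at \<open>a\<close> and miss 0.\<close>
  have null: "AE t in lborel. t \<noteq> a \<and> t \<noteq> a + 1 \<and> t \<noteq> 0 \<and> t \<noteq> 1"
    using AE_lborel_singleton[of a] AE_lborel_singleton[of "a+1"] AE_lborel_singleton[of "0::real"]
      AE_lborel_singleton[of "1::real"] by eventually_elim auto
  have "(\<integral>\<^sup>+t\<in>{0..1}. G (a + t) \<partial>lborel) = (\<integral>\<^sup>+t. G t * indicator {a..a+1} t \<partial>lborel)"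
    by (subst shift[of _ a]) (auto intro!: nn_integral_cong simp: indicator_def)
  also have "\<dots> = (\<integral>\<^sup>+t. G t * indicator {a..1} t + G t * indicator {1<..a+1} t \<partial>lborel)"
    using a by (intro nn_integral_cong) (auto simp: indicator_def)
  also have "\<dots> = (\<integral>\<^sup>+t. G t * indicator {a..1} t \<partial>lborel) + (\<integral>\<^sup>+t. G t * indicator {1<..a+1} t \<partial>lborel)"
    by (rule nn_integral_add) auto
  also have "(\<integral>\<^sup>+t. G t * indicator {1<..a+1} t \<partial>lborel) = (\<integral>\<^sup>+t. G t * indicator {0<..a} t \<partial>lborel)"
    by (subst shift[of _ 1]) (auto intro!: nn_integral_cong simp: indicator_def add.commute[of 1] per)
  also have "(\<integral>\<^sup>+t. G t * indicator {a..1} t \<partial>lborel) + (\<integral>\<^sup>+t. G t * indicator {0<..a} t \<partial>lborel)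
      = (\<integral>\<^sup>+t. G t * indicator {a..1} t + G t * indicator {0<..a} t \<partial>lborel)"
    by (rule nn_integral_add[symmetric]) auto
  also have "\<dots> = (\<integral>\<^sup>+t\<in>{0..1}. G t \<partial>lborel)"
    by (rule nn_integral_cong_AE, use null in eventually_elim) (use a in \<open>auto simp: indicator_def\<close>)
  finally show ?thesis .
qed

subsection \<open>Jensen's formula for linear polynomials\<close>

text \<open>The integrand is the real part of \<open>Ln (1 + w * u)\<close>, holomorphic on the
  closed unit disc, so its mean over the circle is the value \<open>Ln 1 = 0\<close> at the
  centre.\<close>

lemma has_integral_ln_one_plus_cis:
  assumes "cmod w < 1"
  shows "((\<lambda>t. ln (cmod (1 + w * cis (2 * pi * t)))) has_integral 0) {0..1}"
proof -
  let ?f = "\<lambda>u. Ln (1 + w * u)"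
  \<comment> \<open>A positive real part keeps \<open>1 + w * u\<close> away from the branch cut of
    \<open>Ln\<close>.\<close>
  have pos: "0 < Re (1 + w * u)" if "u \<in> cball 0 1" for u
  proof -
    have "cmod (w * u) < 1"
      using assms that mult_left_le[of "cmod u" "cmod w"] by (simp add: norm_mult)
    then show ?thesis using complex_Re_le_cmod[of "- (w * u)"] by simp
  qed
  have "1 + w * u \<notin> \<real>\<^sub>\<le>\<^sub>0" if "u \<in> cball 0 1" for u
    using pos[OF that] by (auto simp: complex_nonpos_Reals_iff)
  then have "?f holomorphic_on cball 0 1"
    by (intro holomorphic_intros) auto
  from Cauchy_integral_circlepath_simple[OF this, of 0]
  have "((\<lambda>u. ?f u / u) has_contour_integral 0) (circlepath 0 1)"
    by simp
  then have "((\<lambda>x. ?f (circlepath 0 1 x) / circlepath 0 1 x *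
       vector_derivative (circlepath 0 1) (at x within {0..1})) has_integral 0) {0..1}"
    by (simp add: has_contour_integral_def)
  \<comment> \<open>On the circle, du = 2 pi i u dx, which cancels the factor 1/u of Cauchy's
    formula.\<close>
  then have "((\<lambda>x. 2 * pi * \<i> * ?f (cis (2 * pi * x))) has_integral 0) {0..1}"
  proof (rule has_integral_eq[rotated])
    fix x :: real assume x: "x \<in> {0..1}"
    have "circlepath 0 1 x = cis (2 * pi * x)"
      by (simp add: circlepath cis_conv_exp mult_ac)
    moreover have "vector_derivative (circlepath 0 1) (at x within {0..1}) = 2 * pi * \<i> * cis (2 * pi * x)"
      using x by (simp add: vector_derivative_circlepath01 cis_conv_exp mult_ac)
    ultimately show "?f (circlepath 0 1 x) / circlepath 0 1 x * vector_derivative (circlepath 0 1) (at x within {0..1})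
        = 2 * pi * \<i> * ?f (cis (2 * pi * x))"
      by simp
  qed
  from has_integral_mult_right[OF this, of "1 / (2 * pi * \<i>)"]
  have "((\<lambda>x. ?f (cis (2 * pi * x))) has_integral 0) {0..1}"
    by simp
  from has_integral_linear[OF this bounded_linear_Re]
  have "((\<lambda>x. Re (?f (cis (2 * pi * x)))) has_integral 0) {0..1}"
    by (simp add: o_def)
  then show ?thesis
  proof (rule has_integral_eq[rotated])
    fix t :: real
    have "0 < Re (1 + w * cis (2 * pi * t))"
      by (rule pos) simp
    then have "1 + w * cis (2 * pi * t) \<noteq> 0"
      by (metis less_irrefl zero_complex.sel(1))
    then show "Re (?f (cis (2 * pi * t))) = ln (cmod (1 + w * cis (2 * pi * t)))"
      by (rule Re_Ln)
  qed
qed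

text \<open>Factoring out the coefficient of larger modulus leaves
  \<open>1 + w * cis (2 * pi * t)\<close> with \<open>cmod w < 1\<close>, whose logarithm has mean
  zero.\<close>

lemma jensen_linear:
  assumes "cmod a \<noteq> cmod b"
  shows "((\<lambda>t. ln (cmod (a + b * cis (2 * pi * t)))) has_integral ln (max (cmod a) (cmod b))) {0..1}"
proof -
  have *: "((\<lambda>t. ln (cmod (a + b * cis (2 * pi * t)))) has_integral ln (cmod a)) {0..1}"
    if less: "cmod b < cmod a" for a b
  proof -
    have a: "a \<noteq> 0" using less by auto
    have ba: "cmod (b / a) < 1" using less a by (simp add: norm_divide divide_less_eq_1)
    have "((\<lambda>t. ln (cmod a) + ln (cmod (1 + b / a * cis (2 * pi * t)))) has_integral ln (cmod a) + 0) {0..1}"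
      using has_integral_add[OF has_integral_const_real[of "ln (cmod a)" 0 1] has_integral_ln_one_plus_cis[OF ba]]
      by simp
    then have "((\<lambda>t. ln (cmod (a + b * cis (2 * pi * t)))) has_integral ln (cmod a) + 0) {0..1}"
    proof (rule has_integral_eq[rotated])
      fix t :: real
      let ?u = "1 + b / a * cis (2 * pi * t)"
      have "cmod (b / a * cis (2 * pi * t)) < 1" using ba by (simp add: norm_mult del: times_divide_eq_left)
      then have "?u \<noteq> 0" by (metis add_eq_0_iff norm_minus_cancel norm_one less_irrefl)
      then have "ln (cmod (a * ?u)) = ln (cmod a) + ln (cmod ?u)"
        using a by (simp add: norm_mult ln_mult)
      then show "ln (cmod a) + ln (cmod ?u) = ln (cmod (a + b * cis (2 * pi * t)))"
        using a by (simp add: distrib_left)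
    qed
    then show ?thesis by simp
  qed
  show ?thesis
  proof (cases "cmod b < cmod a")
    case True
    then show ?thesis using *[OF True] by (simp add: max_def)
  next
    case False
    then have less: "cmod (cnj a) < cmod (cnj b)" using assms by simp
    \<comment> \<open>Conjugating and multiplying by a point of the unit circle preserves the
      modulus and exchanges the two coefficients, which reduces this case to the previous
      one.\<close>
    have "cmod (cnj b + cnj a * cis (2 * pi * t)) = cmod (a + b * cis (2 * pi * t))" for t
    proof -
      have "cmod (cnj b + cnj a * cis (2 * pi * t)) = cmod (cnj (cnj b + cnj a * cis (2 * pi * t)) * cis (2 * pi * t))"
        by (simp only: norm_mult norm_cis complex_mod_cnj)
      also have "cnj (cnj b + cnj a * cis (2 * pi * t)) * cis (2 * pi * t) = a + b * cis (2 * pi * t)"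
        by (simp add: algebra_simps cis_cnj cis_mult)
      finally show ?thesis .
    qed
    with *[OF less] less show ?thesis by (simp add: max_def)
  qed
qed

subsection \<open>The arcsine law and the logarithm of the cosine\<close>

lemma cmod_one_plus_cis: "cmod (1 + cis (2 * t)) = 2 * \<bar>cos t\<bar>"
proof -
  have "1 + cis (2 * t) = cis t * (cis (- t) + cis t)"
    by (simp add: distrib_left cis_mult)
  also have "cis (- t) + cis t = of_real (2 * cos t)"
    by (simp add: complex_eq_iff)
  finally show ?thesis
    by (simp only: norm_mult norm_cis norm_of_real abs_mult)
qed

text \<open>This is Jordan's inequality: the sine is concave on [0, pi/2] and so lies above its
  chord. It keeps \<open>arcsin u / u\<close> bounded near 0.\<close>

lemma arcsin_le_linear:
  assumes "0 \<le> x" "x \<le> 1"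
  shows "arcsin x \<le> pi / 2 * x"
proof -
  have cvx: "convex_on {0..pi/2} (\<lambda>t. - sin t)"
    by (rule f''_ge0_imp_convex[where f' = "\<lambda>t. - cos t" and f'' = sin])
       (auto intro!: derivative_eq_intros sin_ge_zero)
  have "x \<le> sin (pi / 2 * x)"
    using convex_onD[OF cvx, of x 0 "pi / 2"] assms by (simp add: mult.commute)
  moreover have "pi / 2 * x \<le> pi / 2 * 1"
    using assms by (intro mult_left_mono) auto
  ultimately show ?thesis
    using assms by (subst arcsin_le_iff) (auto intro: order_trans[of _ 0])
qed

text \<open>The arcsine law: on [0, pi] the condition confines the angle to the interval between
  \<open>arccos y\<close> and \<open>pi - arccos y\<close>.\<close>

lemma nn_integral_cos_less:
  assumes "0 \<le> y" "y \<le> 1"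
  shows "(\<integral>\<^sup>+t\<in>{0..1}. (if \<bar>cos (pi * t)\<bar> < y then 1 else 0) \<partial>lborel) = ennreal (2 / pi * arcsin y)"
proof -
  let ?a = "arccos y / pi"
  have le: "arccos y \<le> pi / 2"
    using assms by (intro arccos_le_pi2)
  have "(if \<bar>cos (pi * t)\<bar> < y then 1 else 0) * indicator {0..1} t = (indicator {?a<..<1 - ?a} t :: ennreal)" for t
  proof (cases "t \<in> {0..1}")
    case True
    let ?th = "pi * t"
    have th: "0 \<le> ?th" "?th \<le> pi" using True by (auto simp: mult_left_le)
    have "\<bar>cos ?th\<bar> < y \<longleftrightarrow> cos ?th < y \<and> - y < cos ?th" by auto
    also have "cos ?th < y \<longleftrightarrow> arccos y < ?th"
      using arccos_less_mono[of y "cos ?th"] arccos_cos[OF th] assms by auto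
    also have "- y < cos ?th \<longleftrightarrow> ?th < pi - arccos y"
      using arccos_less_mono[of "cos ?th" "- y"] arccos_less_mono[of "-y" "cos ?th"] arccos_cos[OF th] assms by (auto simp: arccos_minus)
    finally show ?thesis using True by (auto simp: indicator_def field_simps)
  next
    case False
    have "0 \<le> ?a" using assms by (simp add: arccos_lbound)
    then show ?thesis using False by (auto simp: indicator_def)
  qed
  then have "(\<integral>\<^sup>+t\<in>{0..1}. (if \<bar>cos (pi * t)\<bar> < y then 1 else 0) \<partial>lborel) = emeasure lborel {?a<..<1 - ?a}"
    by simp
  also have "\<dots> = ennreal (1 - 2 * ?a)"
    using le by (subst emeasure_lborel_Ioo) (auto simp: field_simps)
  also have "1 - 2 * ?a = 2 / pi * arcsin y"
    using assms by (simp add: arcsin_arccos_eq field_simps)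
  finally show ?thesis .
qed

text \<open>Here the angle lies in one of the two end intervals of [0, pi], each of length
  \<open>arccos y\<close>.\<close>

lemma nn_integral_cos_greater:
  assumes "0 \<le> y" "y \<le> 1"
  shows "(\<integral>\<^sup>+t\<in>{0..1}. (if y < \<bar>cos (pi * t)\<bar> then 1 else 0) \<partial>lborel) = ennreal (2 / pi * arccos y)"
proof -
  define a where "a = arccos y / pi"
  have le: "arccos y \<le> pi / 2"
    using assms by (intro arccos_le_pi2)
  have a: "0 \<le> a" "2 * a \<le> 1" using assms le by (auto simp: a_def arccos_lbound field_simps)
  have "(if y < \<bar>cos (pi * t)\<bar> then 1 else 0) * indicator {0..1} t
      = (indicator {0..<a} t + indicator {1 - a<..1} t :: ennreal)" for t
  proof (cases "t \<in> {0..1}")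
    case True
    let ?th = "pi * t"
    have th: "0 \<le> ?th" "?th \<le> pi" using True by (auto simp: mult_left_le)
    have "y < \<bar>cos ?th\<bar> \<longleftrightarrow> y < cos ?th \<or> cos ?th < - y" by auto
    also have "y < cos ?th \<longleftrightarrow> ?th < arccos y"
      using arccos_less_mono[of "cos ?th" y] arccos_less_mono[of y "cos ?th"] arccos_cos[OF th] assms by auto
    also have "cos ?th < - y \<longleftrightarrow> pi - arccos y < ?th"
      using arccos_less_mono[of "cos ?th" "- y"] arccos_less_mono[of "-y" "cos ?th"] arccos_cos[OF th] assms by (auto simp: arccos_minus)
    also have "?th < arccos y \<longleftrightarrow> t < a" by (auto simp: a_def field_simps)
    also have "pi - arccos y < ?th \<longleftrightarrow> 1 - a < t" by (auto simp: a_def field_simps)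
    finally show ?thesis using True a by (auto simp: indicator_def)
  next
    case False
    then show ?thesis using a by (auto simp: indicator_def)
  qed
  then have "(\<integral>\<^sup>+t\<in>{0..1}. (if y < \<bar>cos (pi * t)\<bar> then 1 else 0) \<partial>lborel)
      = emeasure lborel {0..<a} + emeasure lborel {1 - a<..1}"
    by (simp add: nn_integral_add)
  also have "\<dots> = ennreal (2 * a)"
    using a by (simp add: ennreal_plus[symmetric] del: ennreal_plus)
  finally show ?thesis
    by (simp add: a_def)
qed

text \<open>The two conditions confine \<open>u\<close> to D/v < u < C, where 1/u has integral ln C
  - ln (D/v) = ln (v C / D). If v C is at most D, no \<open>u\<close> qualifies and both sides
  vanish.\<close>

lemma nn_integral_layer:
  assumes D: "0 < D" "D \<le> 1" and C: "0 \<le> C" "C \<le> 1" and v: "0 \<le> v" "v \<le> 1"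
  shows "(\<integral>\<^sup>+u\<in>{0<..<1}. ennreal (1 / u) * ((if D < v * u then 1 else 0) * (if u < C then 1 else 0)) \<partial>lborel)
    = ennreal (ln (max (v * C) D) - ln D)"
proof (cases "D < v * C")
  case True
  then have pos: "0 < v" "0 < C"
    using D v C by (auto simp: order_le_less)
  have le: "D / v \<le> C" using True pos by (simp add: field_simps)
  \<comment> \<open>The fundamental theorem is applied on a closed interval, which differs from the
    open one only in these endpoints.\<close>
  have ne: "AE u in lborel. u \<noteq> D / v \<and> u \<noteq> C"
    using AE_lborel_singleton[of "D / v"] AE_lborel_singleton[of C] by eventually_elim auto
  have "(\<integral>\<^sup>+u\<in>{0<..<1}. ennreal (1 / u) * ((if D < v * u then 1 else 0) * (if u < C then 1 else 0)) \<partial>lborel)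
      = (\<integral>\<^sup>+u. ennreal (1 / u) * indicator {D / v..C} u \<partial>lborel)"
  proof (rule nn_integral_cong_AE, use ne in eventually_elim)
    fix u assume u: "u \<noteq> D / v \<and> u \<noteq> C"
    have "0 < D / v" using D pos by simp
    show "ennreal (1 / u) * ((if D < v * u then 1 else 0) * (if u < C then 1 else 0)) * indicator {0<..<1} u
       = ennreal (1 / u) * indicator {D / v..C} u"
    proof (cases "0 < u")
      case True
      with u show ?thesis using pos C by (auto simp: indicator_def field_simps)
    next
      case False
      then have "\<not> D / v \<le> u" using \<open>0 < D / v\<close> by linarith
      with False show ?thesis by (simp add: indicator_def)
    qed
  qed
  also have "\<dots> = ennreal (ln C - ln (D / v))"
  proof (rule nn_integral_FTC_Icc)
    fix u assume "u \<in> {D / v..C}"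
    moreover have "0 < D / v" using D pos by simp
    ultimately have "0 < u" by auto
    then show "(ln has_real_derivative 1 / u) (at u)" "0 \<le> 1 / u"
      by (auto intro!: derivative_eq_intros)
  qed (use le in auto)
  also have "ln C - ln (D / v) = ln (max (v * C) D) - ln D"
    using True pos D by (simp add: ln_div ln_mult max_def)
  finally show ?thesis .
next
  case False
  have "ennreal (1 / u) * ((if D < v * u then 1 else 0) * (if u < C then 1 else 0)) * indicator {0<..<1} u = 0" for u
  proof -
    have "\<not> (D < v * u \<and> u < C)"
      using False v mult_left_mono[of u C v] by auto
    then show ?thesis by (auto simp: indicator_def)
  qed
  then have "(\<integral>\<^sup>+u\<in>{0<..<1}. ennreal (1 / u) * ((if D < v * u then 1 else 0) * (if u < C then 1 else 0)) \<partial>lborel)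
      = (\<integral>\<^sup>+u. 0 \<partial>(lborel :: real measure))"
    by (intro nn_integral_cong)
  then show ?thesis using False by (simp add: max_def)
qed

text \<open>A level set of the cosine is countable. With \<open>q = 0\<close> this removes the zeros
  where \<open>ln 0 = 0\<close> would intrude; other values of \<open>q\<close> remove the ties
  excluded by \<open>jensen_linear\<close>.\<close>

lemma AE_cos_neq: "AE t in lborel. cos (pi * t) \<noteq> q"
proof (cases "\<exists>s. q = cos (pi * s)")
  case True
  then obtain s where q: "q = cos (pi * s)" by blast
  have "{t. cos (pi * t) = q} \<subseteq> (\<lambda>n. s + 2 * n) ` \<int> \<union> (\<lambda>n. - s + 2 * n) ` \<int>"
  proof
    fix t assume "t \<in> {t. cos (pi * t) = q}"
    then obtain n where n: "n \<in> \<int>" and "pi * t = pi * s + 2 * n * pi \<or> pi * t = - (pi * s) + 2 * n * pi"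
      unfolding q by (auto simp: cos_eq)
    then have "pi * t = pi * (s + 2 * n) \<or> pi * t = pi * (- s + 2 * n)"
      by (simp add: algebra_simps)
    then have "t = s + 2 * n \<or> t = - s + 2 * n" by simp
    with n show "t \<in> (\<lambda>n. s + 2 * n) ` \<int> \<union> (\<lambda>n. - s + 2 * n) ` \<int>" by blast
  qed
  then have "countable {t. cos (pi * t) = q}"
    by (rule countable_subset) (auto simp: countable_int)
  from AE_not_in[OF countable_imp_null_set_lborel[OF this]] show ?thesis by simp
qed auto

section \<open>Integrability and mean value of the logarithm of the cosine\<close>

lemma nn_integral_ln_cos_finite:
  "(\<integral>\<^sup>+t\<in>{0..1}. ennreal (- ln \<bar>cos (pi * t)\<bar>) \<partial>lborel) < \<infinity>"
proof -
  \<comment> \<open>The layer formula with v = C = 1 writes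
    \<open>- ln \<bar>cos (pi * t)\<bar>\<close> as an integral over \<open>u\<close>. Tonelli and
    the arcsine law then leave the integral of (2/pi) arcsin(u)/u.\<close>
  let ?g = "\<lambda>t u. ennreal (1 / u) * ((if \<bar>cos (pi * t)\<bar> < u then 1 else 0) * (if u < (1::real) then 1 else 0)) * indicator {0<..<1} u"
  have "(\<integral>\<^sup>+t\<in>{0..1}. ennreal (- ln \<bar>cos (pi * t)\<bar>) \<partial>lborel)
      = (\<integral>\<^sup>+t\<in>{0..1}. (\<integral>\<^sup>+u. ?g t u \<partial>lborel) \<partial>lborel)"
  proof (rule nn_integral_cong_AE, use AE_cos_neq[of 0] in eventually_elim)
    fix t :: real assume "cos (pi * t) \<noteq> 0"
    then show "ennreal (- ln \<bar>cos (pi * t)\<bar>) * indicator {0..1} t = (\<integral>\<^sup>+u. ?g t u \<partial>lborel) * indicator {0..1} t"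
      using nn_integral_layer[of "\<bar>cos (pi * t)\<bar>" 1 1] by (simp add: max_absorb1)
  qed
  also have "\<dots> = (\<integral>\<^sup>+t. (\<integral>\<^sup>+u. ?g t u * indicator {0..1} t \<partial>lborel) \<partial>lborel)"
    by (intro nn_integral_cong nn_integral_multc[symmetric]) measurable
  also have "\<dots> = (\<integral>\<^sup>+u. (\<integral>\<^sup>+t. ?g t u * indicator {0..1} t \<partial>lborel) \<partial>lborel)"
    by (rule lborel_pair.Fubini') measurable
  also have "\<dots> = (\<integral>\<^sup>+u. ennreal (1 / u) * indicator {0<..<1} u *
      (\<integral>\<^sup>+t\<in>{0..1}. (if \<bar>cos (pi * t)\<bar> < u then 1 else 0) \<partial>lborel) \<partial>lborel)"
    by (subst nn_integral_cmult[symmetric]) (auto intro!: nn_integral_cong simp: indicator_def)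
  also have "\<dots> \<le> (\<integral>\<^sup>+u. indicator {0<..<1} u \<partial>(lborel :: real measure))"
  proof (rule nn_integral_mono)
    fix u :: real
    show "ennreal (1 / u) * indicator {0<..<1} u *
      (\<integral>\<^sup>+t\<in>{0..1}. (if \<bar>cos (pi * t)\<bar> < u then 1 else 0) \<partial>lborel) \<le> indicator {0<..<1} u"
    proof (cases "u \<in> {0<..<1}")
      case True
      \<comment> \<open>Jordan's inequality has exactly the constant that makes this bound
        1.\<close>
      have "1 / u * (2 / pi * arcsin u) \<le> 1"
        using arcsin_le_linear[of u] True by (simp add: field_simps)
      then show ?thesis
        using True by (simp add: nn_integral_cos_less ennreal_mult'[symmetric])
    qed simp
  qed
  also have "\<dots> < \<infinity>" by simp
  finally show ?thesis .
qed

lemma set_integrable_ln_cos: "set_integrable lborel {0..1} (\<lambda>t. ln \<bar>cos (pi * t)\<bar>)"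
  unfolding set_integrable_def
proof (rule integrableI_bounded)
  have "(\<integral>\<^sup>+t. norm (indicator {0..1} t *\<^sub>R ln \<bar>cos (pi * t)\<bar>) \<partial>lborel)
      = (\<integral>\<^sup>+t\<in>{0..1}. ennreal (- ln \<bar>cos (pi * t)\<bar>) \<partial>lborel)"
  proof (rule nn_integral_cong)
    fix t :: real
    \<comment> \<open>At a zero of the cosine the convention \<open>ln 0 = 0\<close> preserves the
      sign.\<close>
    have "ln \<bar>cos (pi * t)\<bar> \<le> 0"
      by (cases "cos (pi * t) = 0") auto
    then show "ennreal (norm (indicator {0..1} t *\<^sub>R ln \<bar>cos (pi * t)\<bar>))
       = ennreal (- ln \<bar>cos (pi * t)\<bar>) * indicator {0..1} t"
      by (auto simp: indicator_def)
  qed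
  then show "(\<integral>\<^sup>+t. norm (indicator {0..1} t *\<^sub>R ln \<bar>cos (pi * t)\<bar>) \<partial>lborel) < \<infinity>"
    using nn_integral_ln_cos_finite by simp
qed measurable

text \<open>The boundary case, not covered by \<open>jensen_linear\<close>, follows by letting \<open>r \<rightarrow> 1\<close>.\<close>

lemma set_lebesgue_integral_ln_cos: "(LBINT t:{0..1}. ln (2 * \<bar>cos (pi * t)\<bar>)) = 0"
proof -
  have ln_2_ge: "0 \<le> ln (2::real)" by simp
  have [measurable]: "(\<lambda>t. cis (2 * pi * t)) \<in> borel_measurable borel"
    by (intro borel_measurable_continuous_onI continuous_intros)
  define r :: "nat \<Rightarrow> real" where "r n = 1 - 1 / (n + 1)" for n
  let ?s = "\<lambda>n t. indicator {0..1} t *\<^sub>R ln (cmod (1 + r n * cis (2 * pi * t)))"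
  have r: "0 \<le> r n" "r n < 1" for n by (auto simp: r_def field_simps)
  have r_lim: "r \<longlonglongrightarrow> 1" unfolding r_def by real_asymp
  have "(\<lambda>n. \<integral>t. ?s n t \<partial>lborel) \<longlonglongrightarrow> (\<integral>t. indicator {0..1} t *\<^sub>R ln (2 * \<bar>cos (pi * t)\<bar>) \<partial>lborel)"
  \<comment> \<open>Uniformly in \<open>n\<close>, the modulus of
    \<open>1 + r n * cis (2 * pi * t)\<close> lies between \<open>\<bar>cos (pi * t)\<bar>\<close>
    and 2, which bounds the absolute value of its logarithm.\<close>
  proof (rule integral_dominated_convergence[where w = "\<lambda>t. indicator {0..1} t *\<^sub>R (2 * ln 2 - ln \<bar>cos (pi * t)\<bar>)"])
    show "integrable lborel (\<lambda>t. indicator {0..1::real} t *\<^sub>R (2 * ln 2 - ln \<bar>cos (pi * t)\<bar>))"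
      using set_integral_diff(1)[OF _ set_integrable_ln_cos, of "\<lambda>_. 2 * ln 2"]
      by (simp add: set_integrable_def)
    show "AE t in lborel. (\<lambda>n. ?s n t) \<longlonglongrightarrow> indicator {0..1} t *\<^sub>R ln (2 * \<bar>cos (pi * t)\<bar>)"
    proof (use AE_cos_neq[of 0] in eventually_elim)
      fix t :: real assume "cos (pi * t) \<noteq> 0"
      then have "cmod (1 + 1 * cis (2 * pi * t)) \<noteq> 0"
        using cmod_one_plus_cis[of "pi * t"] by (simp add: mult.assoc)
      then have "(\<lambda>n. ?s n t) \<longlonglongrightarrow> indicator {0..1} t *\<^sub>R ln (cmod (1 + of_real 1 * cis (2 * pi * t)))"
        by (intro tendsto_intros r_lim) auto
      then show "(\<lambda>n. ?s n t) \<longlonglongrightarrow> indicator {0..1} t *\<^sub>R ln (2 * \<bar>cos (pi * t)\<bar>)"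
        using cmod_one_plus_cis[of "pi * t"] by (simp add: mult.assoc)
    qed
    show "AE t in lborel. norm (?s n t) \<le> indicator {0..1} t *\<^sub>R (2 * ln 2 - ln \<bar>cos (pi * t)\<bar>)" for n
    proof (use AE_cos_neq[of 0] in eventually_elim)
      fix t :: real assume nz: "cos (pi * t) \<noteq> 0"
      let ?c = "\<bar>cos (pi * t)\<bar>" and ?w = "of_real (r n) * cis (2 * pi * t)"
      have w: "cmod ?w = r n" using r[of n] by (simp add: norm_mult)
      have up: "cmod (1 + ?w) \<le> 2"
        using norm_triangle_ineq[of 1 ?w] w r(2)[of n] by simp
      \<comment> \<open>Moving from the circle of radius 1 to radius \<open>r n\<close> costs
        \<open>1 - r n\<close>, which is itself at most \<open>cmod (1 + ?w)\<close>. So twice the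
        cosine is at most twice this modulus.\<close>
      have "2 * ?c = cmod ((1 + ?w) + of_real (1 - r n) * cis (2 * pi * t))"
        using cmod_one_plus_cis[of "pi * t"] by (simp add: algebra_simps)
      also have "\<dots> \<le> cmod (1 + ?w) + (1 - r n)"
        using norm_triangle_ineq[of "1 + ?w" "of_real (1 - r n) * cis (2 * pi * t)"] r[of n]
        by (simp only: norm_mult norm_of_real norm_cis) simp
      also have "1 - r n \<le> cmod (1 + ?w)"
        using norm_diff_ineq[of 1 ?w] w by simp
      finally have low: "?c \<le> cmod (1 + ?w)" by simp
      have pos: "0 < ?c" using nz by simp
      have "ln ?c \<le> ln (cmod (1 + ?w))"
        using low pos by (subst ln_le_cancel_iff) linarith+
      moreover have "ln (cmod (1 + ?w)) \<le> ln 2"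
        using low up pos by (subst ln_le_cancel_iff) linarith+
      moreover have "ln ?c \<le> 0" using pos by simp
      ultimately have "\<bar>ln (cmod (1 + ?w))\<bar> \<le> 2 * ln 2 - ln ?c"
        using ln_2_ge by linarith
      then show "norm (?s n t) \<le> indicator {0..1} t *\<^sub>R (2 * ln 2 - ln ?c)"
        by (auto simp: indicator_def)
    qed
  qed measurable
  moreover have "(\<integral>t. ?s n t \<partial>lborel) = 0" for n
  proof -
    let ?h = "\<lambda>t. ln (cmod (1 + r n * cis (2 * pi * t)))"
    have "1 + r n * cis (2 * pi * t) \<noteq> 0" for t
    proof -
      have "cmod (of_real (r n) * cis (2 * pi * t)) < 1" using r[of n] by (simp add: norm_mult)
      then show ?thesis by (metis add_eq_0_iff norm_minus_cancel norm_one less_irrefl)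
    qed
    then have "set_integrable lborel {0..1} ?h"
      by (intro borel_integrable_atLeastAtMost' continuous_intros) (auto simp: cis_conv_exp intro!: continuous_intros)
    from set_borel_integral_eq_integral(2)[OF this]
    show ?thesis
      using has_integral_ln_one_plus_cis[of "of_real (r n)"] r[of n]
      by (simp add: set_lebesgue_integral_def integral_unique)
  qed
  ultimately show ?thesis
    unfolding set_lebesgue_integral_def by (simp add: LIMSEQ_const_iff)
qed

subsection \<open>The arcsine series\<close>

text \<open>The coefficients of the binomial series of \<open>1 / sqrt (1 - t\<^sup>2)\<close> in powers of \<open>t\<^sup>2\<close>.\<close>

definition arcsin_coeff :: "nat \<Rightarrow> real" where
  "arcsin_coeff n = (-1) ^ n * ((-1/2) gchoose n)"

lemma arcsin_coeff_0 [simp]: "arcsin_coeff 0 = 1"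
  by (simp add: arcsin_coeff_def)

text \<open>With the value 1 at 0, this recursion identifies the coefficients as binomial(2n, n) /
  4^n. It yields their positivity and drives the induction for the arccosine moments.\<close>

lemma arcsin_coeff_Suc: "arcsin_coeff (Suc n) * (2 * n + 2) = arcsin_coeff n * (2 * n + 1)"
proof -
  have "((-1/2 :: real) gchoose Suc n) * (2 * n + 2) = - ((-1/2) gchoose n) * (2 * n + 1)"
    using gbinomial_mult_1[of "-1/2::real" n]
    by (simp add: algebra_simps)
  moreover have "arcsin_coeff (Suc n) * (2 * n + 2)
      = - ((-1) ^ n) * (((-1/2) gchoose Suc n) * (2 * n + 2))"
    by (simp add: arcsin_coeff_def)
  ultimately show ?thesis
    by (simp add: arcsin_coeff_def)
qed

lemma arcsin_coeff_pos: "0 < arcsin_coeff n"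
proof (induction n)
  case (Suc n)
  have "0 < arcsin_coeff (Suc n) * (2 * n + 2)"
    unfolding arcsin_coeff_Suc using Suc by simp
  then show ?case by (simp add: zero_less_mult_iff)
qed simp

lemma arcsin_coeff_sums:
  assumes "\<bar>t\<bar> < 1"
  shows "(\<lambda>n. arcsin_coeff n * t ^ (2 * n)) sums (1 / sqrt (1 - t\<^sup>2))"
proof -
  have "\<bar>- (t\<^sup>2)\<bar> < 1" using assms by (simp add: abs_square_less_1)
  from gen_binomial_real[OF this, of "-1/2"]
  have "(\<lambda>n. ((-1/2) gchoose n) * (- (t\<^sup>2)) ^ n) sums (1 - t\<^sup>2) powr (- (1/2))"
    by simp
  also have "(1 - t\<^sup>2) powr (- (1/2)) = 1 / sqrt (1 - t\<^sup>2)"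
    using assms by (simp add: powr_minus powr_half_sqrt abs_square_less_1 less_imp_le inverse_eq_divide)
  also have "(\<lambda>n. ((-1/2) gchoose n) * (- (t\<^sup>2)) ^ n) = (\<lambda>n. arcsin_coeff n * t ^ (2 * n))"
  proof
    fix n
    have "(- (t\<^sup>2)) ^ n = (-1) ^ n * t ^ (2 * n)"
      by (subst power_minus) (simp add: power_mult)
    then show "((-1/2) gchoose n) * (- (t\<^sup>2)) ^ n = arcsin_coeff n * t ^ (2 * n)"
      by (simp only: arcsin_coeff_def mult_ac)
  qed
  finally show ?thesis .
qed

text \<open>The binomial series of the derivative of \<open>arcsin\<close> is integrated term by
  term from 0 to \<open>y\<close>. All terms are nonnegative, so sum and integral may be exchanged
  in \<open>ennreal\<close> without a convergence argument.\<close>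

lemma arcsin_suminf_ennreal:
  assumes y: "0 \<le> y" "y < 1"
  shows "ennreal (arcsin y) = (suminf (\<lambda>n. ennreal (arcsin_coeff n * y ^ (2 * n + 1) / (2 * n + 1))))"
proof -
  have t: "\<bar>t\<bar> < 1" "0 < 1 - t\<^sup>2" if "t \<in> {0..y}" for t
    using that y by (auto simp: abs_square_less_1)
  have "ennreal (arcsin y) = ennreal (arcsin y - arcsin 0)" by simp
  also have "\<dots> = (\<integral>\<^sup>+t. ennreal (1 / sqrt (1 - t\<^sup>2)) * indicator {0..y} t \<partial>lborel)"
  proof (rule nn_integral_FTC_Icc[symmetric])
    fix t assume "t \<in> {0..y}"
    then have "\<bar>t\<bar> < 1" "t\<^sup>2 \<le> 1" using t[of t] by auto
    then show "(arcsin has_real_derivative 1 / sqrt (1 - t\<^sup>2)) (at t)" "0 \<le> 1 / sqrt (1 - t\<^sup>2)"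
      by (auto intro!: derivative_eq_intros simp: divide_inverse)
  qed (use y in auto)
  also have "\<dots> = (\<integral>\<^sup>+t. (suminf (\<lambda>n. ennreal (arcsin_coeff n * t ^ (2 * n)) * indicator {0..y} t)) \<partial>lborel)"
  proof (rule nn_integral_cong)
    fix t :: real
    have "ennreal (1 / sqrt (1 - t\<^sup>2)) = (suminf (\<lambda>n. ennreal (arcsin_coeff n * t ^ (2 * n))))" if "t \<in> {0..y}"
      using arcsin_coeff_sums[OF t(1)[OF that]] less_imp_le[OF arcsin_coeff_pos] that
      by (subst suminf_ennreal2) (auto simp: sums_iff)
    then show "ennreal (1 / sqrt (1 - t\<^sup>2)) * indicator {0..y} t
        = (suminf (\<lambda>n. ennreal (arcsin_coeff n * t ^ (2 * n)) * indicator {0..y} t))"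
      by (auto simp: indicator_def)
  qed
  also have "\<dots> = (suminf (\<lambda>n. \<integral>\<^sup>+t. ennreal (arcsin_coeff n * t ^ (2 * n)) * indicator {0..y} t \<partial>lborel))"
    by (rule nn_integral_suminf) measurable
  also have "\<dots> = (suminf (\<lambda>n. ennreal (arcsin_coeff n * y ^ (2 * n + 1) / (2 * n + 1))))"
  proof (rule suminf_cong)
    fix n
    have "(\<integral>\<^sup>+t. ennreal (arcsin_coeff n * t ^ (2 * n)) * indicator {0..y} t \<partial>lborel)
      = ennreal (arcsin_coeff n * y ^ (2 * n + 1) / (2 * n + 1) - arcsin_coeff n * 0 ^ (2 * n + 1) / (2 * n + 1))"
    proof (rule nn_integral_FTC_Icc)
      fix t :: real assume "t \<in> {0..y}"
      show "((\<lambda>t. arcsin_coeff n * t ^ (2 * n + 1) / (2 * n + 1)) has_real_derivative arcsin_coeff n * t ^ (2 * n)) (at t)"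
        by (rule derivative_eq_intros refl | simp)+
      show "0 \<le> arcsin_coeff n * t ^ (2 * n)"
        using arcsin_coeff_pos[of n] by simp
    qed (use y in auto)
    then show "(\<integral>\<^sup>+t. ennreal (arcsin_coeff n * t ^ (2 * n)) * indicator {0..y} t \<partial>lborel)
      = ennreal (arcsin_coeff n * y ^ (2 * n + 1) / (2 * n + 1))" by simp
  qed
  finally show ?thesis .
qed

section \<open>Moments of the arccosine\<close>

lemma continuous_on_arccos_unit [continuous_intros]: "continuous_on {0..1} arccos"
  by (rule continuous_on_subset[OF continuous_on_arccos']) auto

lemma has_integral_arccos: "(arccos has_integral 1) {0..1}"
proof -
  let ?F = "\<lambda>u. u * arccos u - sqrt (1 - u\<^sup>2)"
  have "(arccos has_integral (?F 1 - ?F 0)) {0..1}"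
  \<comment> \<open>The derivative of \<open>arccos\<close> blows up at 1, so differentiability is
    used only in the interior, with continuity at the ends.\<close>
  proof (rule fundamental_theorem_of_calculus_interior)
    show "continuous_on {0..1} ?F" by (intro continuous_intros)
    fix u :: real assume u: "u \<in> {0<..<1}"
    then have "u\<^sup>2 < 1" by (simp add: power_less_one_iff abs_square_less_1)
    then have "(?F has_real_derivative arccos u) (at u)"
      using u by (auto intro!: derivative_eq_intros simp: field_simps)
    then show "(?F has_vector_derivative arccos u) (at u)"
      by (simp add: has_real_derivative_iff_has_vector_derivative)
  qed simp
  then show ?thesis by simp
qed

text \<open>Integration by parts, written out as an explicit primitive that vanishes at both ends.\<close>

lemma has_integral_power_arccos_step:
  "((\<lambda>u. real (m + 3) ^ 2 * (u ^ (m + 2) * arccos u) - real (m + 2) * real (m + 1) * (u ^ m * arccos u))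
     has_integral 0) {0..1}"
proof -
  let ?F = "\<lambda>u. real (m + 3) * u ^ (m + 3) * arccos u - real (m + 2) * u ^ (m + 1) * arccos u
    - u ^ (m + 2) * sqrt (1 - u\<^sup>2)"
  let ?f = "\<lambda>u. real (m + 3) ^ 2 * (u ^ (m + 2) * arccos u) - real (m + 2) * real (m + 1) * (u ^ m * arccos u)"
  have "(?f has_integral (?F 1 - ?F 0)) {0..1}"
  proof (rule fundamental_theorem_of_calculus_interior)
    show "continuous_on {0..1} ?F" by (intro continuous_intros)
    fix u :: real assume u: "u \<in> {0<..<1}"
    define s where "s = sqrt (1 - u\<^sup>2)"
    have "u\<^sup>2 < 1" using u by (simp add: power_less_one_iff abs_square_less_1)
    then have s: "0 < s" "s\<^sup>2 = 1 - u\<^sup>2" by (auto simp: s_def)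
    have d_pow: "((\<lambda>u. u ^ (m + 3)) has_real_derivative real (m + 3) * u ^ (m + 2)) (at u)"
      "((\<lambda>u. u ^ (m + 2)) has_real_derivative real (m + 2) * u ^ (m + 1)) (at u)"
      "((\<lambda>u. u ^ (m + 1)) has_real_derivative real (m + 1) * u ^ m) (at u)"
      using DERIV_pow[of "m + 3" u UNIV] DERIV_pow[of "m + 2" u UNIV] DERIV_pow[of "m + 1" u UNIV]
      by (simp_all add: eval_nat_numeral)
    have d_arccos: "(arccos has_real_derivative - (1 / s)) (at u)"
      using u unfolding s_def by (auto intro!: derivative_eq_intros simp: divide_inverse)
    have d_sqrt: "((\<lambda>u. sqrt (1 - u\<^sup>2)) has_real_derivative - (u / s)) (at u)"
    proof -
      have "((\<lambda>u. 1 - u\<^sup>2) has_real_derivative - (2 * u)) (at u)"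
        by (auto intro!: derivative_eq_intros)
      moreover have "(sqrt has_real_derivative inverse (sqrt (1 - u\<^sup>2)) / 2) (at (1 - u\<^sup>2))"
        using \<open>u\<^sup>2 < 1\<close> by (intro DERIV_real_sqrt) simp
      ultimately have "((\<lambda>u. sqrt (1 - u\<^sup>2)) has_real_derivative inverse s / 2 * - (2 * u)) (at u)"
        unfolding s_def by (rule DERIV_chain2[where f = sqrt and g = "\<lambda>u. 1 - u\<^sup>2", rotated])
      moreover have "inverse s / 2 * - (2 * u) = - (u / s)"
        by (simp add: field_simps)
      ultimately show ?thesis by (simp only:)
    qed
    have pow: "u ^ (m + 3) = u ^ m * u ^ 3" "u ^ (m + 2) = u ^ m * u\<^sup>2" "u ^ (m + 1) = u ^ m * u"
      by (simp_all add: power_add power2_eq_square power3_eq_cube)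
    \<comment> \<open>With p = u^m and c = arccos u, the terms free of \<open>c\<close> collect into
      a multiple of \<open>1 - u\<^sup>2 - s\<^sup>2\<close>, which is zero.\<close>
    have alg: "A * (A * (p * u\<^sup>2)) * c + - (1 / s) * (A * (p * u ^ 3))
        - (B * (C * p) * c + - (1 / s) * (B * (p * u))) - (B * (p * u) * s + - (u / s) * (p * u\<^sup>2))
      = A\<^sup>2 * (p * u\<^sup>2 * c) - B * C * (p * c) + B * (p * u) * (1 - u\<^sup>2 - s\<^sup>2) / s"
      if "A = B + 1" for A B C p c
      using s(1) that by (simp add: field_simps power2_eq_square power3_eq_cube)
    have "(?F has_real_derivative
        real (m + 3) * (real (m + 3) * u ^ (m + 2)) * arccos u + - (1 / s) * (real (m + 3) * u ^ (m + 3))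
        - (real (m + 2) * (real (m + 1) * u ^ m) * arccos u + - (1 / s) * (real (m + 2) * u ^ (m + 1)))
        - (real (m + 2) * u ^ (m + 1) * sqrt (1 - u\<^sup>2) + - (u / s) * u ^ (m + 2))) (at u)"
      by (intro DERIV_diff DERIV_mult DERIV_cmult d_pow d_arccos d_sqrt)
    then have "(?F has_real_derivative ?f u) (at u)"
    proof (rule DERIV_cong)
      show "real (m + 3) * (real (m + 3) * u ^ (m + 2)) * arccos u + - (1 / s) * (real (m + 3) * u ^ (m + 3))
        - (real (m + 2) * (real (m + 1) * u ^ m) * arccos u + - (1 / s) * (real (m + 2) * u ^ (m + 1)))
        - (real (m + 2) * u ^ (m + 1) * sqrt (1 - u\<^sup>2) + - (u / s) * u ^ (m + 2)) = ?f u"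
        unfolding pow s_def[symmetric] by (subst alg) (simp_all add: s(2))
    qed
    then show "(?F has_vector_derivative ?f u) (at u)"
      by (simp add: has_real_derivative_iff_has_vector_derivative)
  qed simp
  moreover have "?F 1 - ?F 0 = 0"
    by (simp add: zero_power)
  ultimately show ?thesis by (simp only:)
qed

text \<open>The preceding integral relates consecutive even moments by the factor
  (2n+2)(2n+1)/(2n+3)^2, and \<open>arcsin_coeff_Suc\<close> matches it. The coefficient in the
  denominator will cancel against the arcsine series.\<close>

lemma has_integral_power_arccos:
  "((\<lambda>u. u ^ (2 * n) * arccos u) has_integral 1 / (arcsin_coeff n * (2 * n + 1)\<^sup>2)) {0..1}"
proof (induction n)
  case 0
  then show ?case using has_integral_arccos by simp
next
  case (Suc n)
  let ?M = "1 / (arcsin_coeff n * (2 * n + 1)\<^sup>2)"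
  have "((\<lambda>u. real (2 * n + 3) ^ 2 * (u ^ (2 * n + 2) * arccos u)) has_integral
      0 + real (2 * n + 2) * real (2 * n + 1) * ?M) {0..1}"
    using has_integral_add[OF has_integral_power_arccos_step[of "2 * n"]
        has_integral_mult_right[OF Suc, of "real (2 * n + 2) * real (2 * n + 1)"]]
    by simp
  from has_integral_mult_right[OF this, of "1 / real (2 * n + 3) ^ 2"]
  have "((\<lambda>u. u ^ (2 * Suc n) * arccos u) has_integral
      1 / real (2 * n + 3) ^ 2 * (real (2 * n + 2) * real (2 * n + 1) * ?M)) {0..1}"
    by (simp add: field_simps)
  also have "1 / real (2 * n + 3) ^ 2 * (real (2 * n + 2) * real (2 * n + 1) * ?M)
      = 1 / (arcsin_coeff (Suc n) * (2 * Suc n + 1)\<^sup>2)"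
  proof -
    have "arcsin_coeff (Suc n) = arcsin_coeff n * (2 * n + 1) / (2 * n + 2)"
      using arcsin_coeff_Suc[of n] by (simp add: field_simps)
    moreover have "1 / c\<^sup>2 * (b * a * (1 / (C * a\<^sup>2))) = 1 / (C * a / b * c\<^sup>2)"
      if "a \<noteq> 0" "b \<noteq> 0" "c \<noteq> 0" "C \<noteq> 0" for a b c C :: real
      using that by (simp add: field_simps power2_eq_square)
    from this[of "2 * real n + 1" "2 * real n + 2" "2 * real n + 3" "arcsin_coeff n"]
    have "1 / (2 * real n + 3)\<^sup>2 * ((2 * real n + 2) * (2 * real n + 1) * (1 / (arcsin_coeff n * (2 * real n + 1)\<^sup>2)))
        = 1 / (arcsin_coeff n * (2 * real n + 1) / (2 * real n + 2) * (2 * real n + 3)\<^sup>2)"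
      using arcsin_coeff_pos[of n] by simp
    ultimately show ?thesis
      by (simp add: add.commute)
  qed
  finally show ?case .
qed

section \<open>The odd part of the trilogarithm\<close>

definition legendre_chi3 :: "real \<Rightarrow> real" where
  "legendre_chi3 v = (suminf (\<lambda>n. v ^ (2 * n + 1) / (2 * n + 1) ^ 3))"

lemma summable_Li3:
  assumes "\<bar>x\<bar> \<le> (1::real)"
  shows "summable (\<lambda>n. x ^ Suc n / of_nat (Suc n) ^ 3)"
proof (rule summable_comparison_test')
  show "summable (\<lambda>n. 1 / real (Suc n) ^ 3)"
    using inverse_power_summable[of 3, where ?'a = real] by (subst summable_Suc_iff) (simp add: inverse_eq_divide)
  show "norm (x ^ Suc n / of_nat (Suc n) ^ 3) \<le> 1 / real (Suc n) ^ 3" for n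
    using assms power_le_one[of "\<bar>x\<bar>" "Suc n"]
    by (simp add: abs_mult power_abs divide_right_mono del: power_Suc of_nat_Suc)
qed

text \<open>In \<open>Li3 v - Li3 (- v)\<close> the even powers cancel and the odd ones double.
  Dropping the vanishing terms by the reindexing n to 2n changes neither summability nor the
  sum.\<close>

lemma
  assumes "\<bar>v\<bar> \<le> 1"
  shows legendre_chi3_summable: "summable (\<lambda>n. v ^ (2 * n + 1) / (2 * n + 1) ^ 3)"
    and legendre_chi3_eq_Li3: "legendre_chi3 v = (Li3 v - Li3 (- v)) / 2"
proof -
  define f where "f n = (v ^ Suc n / of_nat (Suc n) ^ 3 - (- v) ^ Suc n / of_nat (Suc n) ^ 3) / 2" for n
  \<comment> \<open>Index \<open>n\<close> carries exponent \<open>n + 1\<close>, so the odd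
    exponents sit at the even indices.\<close>
  define g :: "nat \<Rightarrow> nat" where "g n = 2 * n" for n
  have g: "strict_mono g" by (simp add: g_def strict_mono_def)
  have f0: "f n = 0" if "n \<notin> range g" for n
  proof -
    have "odd n" using that by (auto simp: g_def elim: evenE)
    then show ?thesis by (simp add: f_def)
  qed
  have fg: "f (g n) = v ^ (2 * n + 1) / (2 * n + 1) ^ 3" for n
    by (simp add: f_def g_def power_minus_even diff_divide_distrib[symmetric])
  have sum: "summable (\<lambda>n. v ^ Suc n / of_nat (Suc n) ^ 3)" "summable (\<lambda>n. (- v) ^ Suc n / of_nat (Suc n) ^ 3)"
    using summable_Li3[of v] summable_Li3[of "- v"] assms by auto
  have f: "summable f"
    unfolding f_def by (intro summable_divide summable_diff sum)
  then show "summable (\<lambda>n. v ^ (2 * n + 1) / (2 * n + 1) ^ 3)"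
    using summable_mono_reindex[OF g, of f] f0 fg by simp
  have "legendre_chi3 v = suminf f"
    unfolding legendre_chi3_def using suminf_mono_reindex[OF g, of f] f0 fg by simp
  also have "\<dots> = (Li3 v - Li3 (- v)) / 2"
    unfolding f_def Li3_def using sum by (simp add: suminf_divide summable_diff suminf_diff del: power_Suc of_nat_Suc)
  finally show "legendre_chi3 v = (Li3 v - Li3 (- v)) / 2" .
qed

lemma legendre_chi3_nonneg:
  assumes "0 \<le> v" "v \<le> 1"
  shows "0 \<le> legendre_chi3 v"
  unfolding legendre_chi3_def by (rule suminf_nonneg) (use assms legendre_chi3_summable[of v] in auto)

section \<open>The integral of arcsin(v u) arccos(u) / u\<close>

lemma continuous_on_arcsin_mult:
  assumes "0 \<le> v" "v \<le> 1"
  shows "continuous_on {0..1} (\<lambda>u. arcsin (v * u))"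
proof (rule continuous_on_arcsin)
  show "\<forall>u\<in>{0..1}. - 1 \<le> v * u \<and> v * u \<le> 1"
  proof
    fix u :: real assume "u \<in> {0..1}"
    then have "0 \<le> v * u" "v * u \<le> 1" using assms by (auto intro: mult_le_one)
    then show "- 1 \<le> v * u \<and> v * u \<le> 1" by linarith
  qed
qed (intro continuous_intros)

text \<open>The factors are meaningful only on [-1, 1], so measurability comes from continuity on
  the open interval, the indicator hiding everything outside.\<close>

lemma borel_measurable_arcsin_arccos:
  assumes "0 \<le> v" "v \<le> 1"
  shows "(\<lambda>u. ennreal (arcsin (v * u) * arccos u / u) * indicator {0<..<1} u) \<in> borel_measurable borel"
proof -
  have "(\<lambda>u. indicator {0<..<1} u *\<^sub>R (arcsin (v * u) * arccos u / u)) \<in> borel_measurable borel"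
  proof (rule borel_measurable_continuous_on_indicator)
    have sub: "{0<..<1} \<subseteq> {0..1::real}" by auto
    show "continuous_on {0<..<1} (\<lambda>u. arcsin (v * u) * arccos u / u)"
      by (intro continuous_intros continuous_on_subset[OF continuous_on_arcsin_mult[OF assms] sub]
          continuous_on_subset[OF continuous_on_arccos_unit sub]) auto
  qed simp
  then have "(\<lambda>u. ennreal (indicator {0<..<1} u *\<^sub>R (arcsin (v * u) * arccos u / u))) \<in> borel_measurable borel"
    by simp
  then show ?thesis
    by (rule measurable_cong[THEN iffD1, rotated]) (auto simp: indicator_def)
qed

text \<open>Expanding \<open>arcsin (v * u)\<close> and dividing by \<open>u\<close> leaves even
  powers of \<open>u\<close> times \<open>arccos u\<close>, whose moments are known.\<close>

lemma nn_integral_arcsin_arccos: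
  assumes v: "0 \<le> v" "v \<le> 1"
  shows "(\<integral>\<^sup>+u\<in>{0<..<1}. ennreal (arcsin (v * u) * arccos u / u) \<partial>lborel) = ennreal (legendre_chi3 v)"
proof -
  let ?c = "\<lambda>n. arcsin_coeff n * v ^ (2 * n + 1) / (2 * n + 1)"
  let ?h = "\<lambda>n u. u ^ (2 * n) * arccos u"
  have c: "0 \<le> ?c n" for n using arcsin_coeff_pos[of n] v by simp
  have meas: "(\<lambda>u. ennreal (?h n u) * indicator {0..1} u) \<in> borel_measurable lborel" for n
  proof -
    have "(\<lambda>u. indicator {0..1} u *\<^sub>R ?h n u) \<in> borel_measurable borel"
      by (rule borel_measurable_continuous_on_indicator) (auto intro!: continuous_intros)
    then have "(\<lambda>u. ennreal (indicator {0..1} u *\<^sub>R ?h n u)) \<in> borel_measurable lborel"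
      by simp
    then show ?thesis
      by (rule measurable_cong[THEN iffD1, rotated]) (auto simp: indicator_def)
  qed
  have "(\<integral>\<^sup>+u\<in>{0<..<1}. ennreal (arcsin (v * u) * arccos u / u) \<partial>lborel)
      = (\<integral>\<^sup>+u. (suminf (\<lambda>n. ennreal (?c n) * (ennreal (?h n u) * indicator {0..1} u))) \<partial>lborel)"
  proof (rule nn_integral_cong_AE, use AE_lborel_singleton[of 0] AE_lborel_singleton[of 1] in eventually_elim)
    fix u :: real assume ne: "u \<noteq> 0" "u \<noteq> 1"
    show "ennreal (arcsin (v * u) * arccos u / u) * indicator {0<..<1} u
        = (suminf (\<lambda>n. ennreal (?c n) * (ennreal (?h n u) * indicator {0..1} u)))"
    proof (cases "u \<in> {0<..<1}")
      case True
      \<comment> \<open>Since \<open>u < 1\<close>, the argument is strictly below 1 even for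
        \<open>v = 1\<close>, so the series applies.\<close>
      have "v * u \<le> 1 * u"
        using True v by (intro mult_right_mono) auto
      moreover have "u < 1" using True by simp
      ultimately have "v * u < 1" by linarith
      moreover have "0 \<le> v * u" using True v by simp
      ultimately have vu: "0 \<le> v * u" "v * u < 1" by auto
      have ac: "0 \<le> arccos u / u" using True by (simp add: arccos_lbound)
      have "ennreal (arcsin (v * u) * arccos u / u) = ennreal (arcsin (v * u)) * ennreal (arccos u / u)"
        using ennreal_mult''[OF ac, of "arcsin (v * u)"] by simp
      also have "\<dots> = (suminf (\<lambda>n. ennreal (arcsin_coeff n * (v * u) ^ (2 * n + 1) / (2 * n + 1)) * ennreal (arccos u / u)))"
        by (subst arcsin_suminf_ennreal[OF vu]) simp
      also have "\<dots> = (suminf (\<lambda>n. ennreal (?c n) * (ennreal (?h n u) * indicator {0..1} u)))"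
      proof (rule suminf_cong)
        fix n
        have "arcsin_coeff n * (v * u) ^ (2 * n + 1) / (2 * n + 1) * (arccos u / u) = ?c n * ?h n u"
          using True by (simp add: power_mult_distrib field_simps)
        moreover have "0 \<le> ?h n u" "indicator {0..1} u = (1 :: ennreal)"
          using True by (auto simp: arccos_lbound)
        ultimately show "ennreal (arcsin_coeff n * (v * u) ^ (2 * n + 1) / (2 * n + 1)) * ennreal (arccos u / u)
            = ennreal (?c n) * (ennreal (?h n u) * indicator {0..1} u)"
          by (simp only: mult_1_right ennreal_mult''[symmetric] ac)
      qed
      finally show ?thesis using True by simp
    next
      case False
      then show ?thesis using ne by (auto simp: indicator_def)
    qed
  qed
  also have "\<dots> = (suminf (\<lambda>n. \<integral>\<^sup>+u. ennreal (?c n) * (ennreal (?h n u) * indicator {0..1} u) \<partial>lborel))"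
    by (intro nn_integral_suminf borel_measurable_times_ennreal meas) simp
  also have "\<dots> = (suminf (\<lambda>n. ennreal (v ^ (2 * n + 1) / (2 * n + 1) ^ 3)))"
  proof (rule suminf_cong)
    fix n
    have "(\<integral>\<^sup>+u. ennreal (?c n) * (ennreal (?h n u) * indicator {0..1} u) \<partial>lborel)
        = ennreal (?c n) * ennreal (1 / (arcsin_coeff n * (2 * n + 1)\<^sup>2))"
      by (subst nn_integral_cmult[OF meas], subst nn_integral_has_integral_lebesgue'[OF _ has_integral_power_arccos])
         (auto simp: arccos_lbound)
    also have "\<dots> = ennreal (?c n * (1 / (arcsin_coeff n * (2 * n + 1)\<^sup>2)))"
      by (rule ennreal_mult[symmetric]) (use c[of n] arcsin_coeff_pos[of n] in auto)
    \<comment> \<open>The arcsine coefficients cancel; one factor 2n+1 from the series and two from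
      the moment make the cube.\<close>
    also have "?c n * (1 / (arcsin_coeff n * (2 * n + 1)\<^sup>2)) = v ^ (2 * n + 1) / (2 * n + 1) ^ 3"
    proof -
      have "C * w / m * (1 / (C * m\<^sup>2)) = w / m ^ 3" if "C \<noteq> 0" for C w m :: real
        using that by (simp add: power2_eq_square power3_eq_cube)
      from this[of "arcsin_coeff n" "v ^ (2 * n + 1)" "real (2 * n + 1)"] arcsin_coeff_pos[of n]
      show ?thesis by (simp only: of_nat_power)
    qed
    finally show "(\<integral>\<^sup>+u. ennreal (?c n) * (ennreal (?h n u) * indicator {0..1} u) \<partial>lborel)
        = ennreal (v ^ (2 * n + 1) / (2 * n + 1) ^ 3)" .
  qed
  also have "\<dots> = ennreal (legendre_chi3 v)"
    unfolding legendre_chi3_def by (rule suminf_ennreal2) (use v legendre_chi3_summable[of v] in auto)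
  finally show ?thesis .
qed

subsection \<open>The Mahler measure\<close>

text \<open>The integrand is ln 4 - ln (2 |cos|), so this is the vanishing mean of ln (2 |cos|) in
  nonnegative form.\<close>

lemma nn_integral_ln_two_cos:
  "(\<integral>\<^sup>+t\<in>{0..1}. ennreal (ln 2 - ln \<bar>cos (pi * t)\<bar>) \<partial>lborel) = ennreal (ln 4)"
proof -
  let ?f = "\<lambda>t. indicator {0..1} t *\<^sub>R (ln 2 - ln \<bar>cos (pi * t)\<bar>)"
  have ln_cos: "ln \<bar>cos x\<bar> \<le> 0" for x :: real
    by (cases "cos x = 0") auto
  have const: "set_integrable lborel {0..1} (\<lambda>_::real. c)" for c :: real
    by (simp add: set_integrable_def)
  have int: "set_integrable lborel {0..1} (\<lambda>t. ln 2 - ln \<bar>cos (pi * t)\<bar>)"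
    by (rule set_integral_diff(1)[OF const set_integrable_ln_cos])
  have "(LBINT t:{0..1}. ln (2 * \<bar>cos (pi * t)\<bar>)) = (LBINT t:{0..1}. 2 * ln 2 - (ln 2 - ln \<bar>cos (pi * t)\<bar>))"
    unfolding set_lebesgue_integral_def
  proof (rule integral_cong_AE)
    show "AE t in lborel. indicator {0..1} t *\<^sub>R ln (2 * \<bar>cos (pi * t)\<bar>)
        = indicator {0..1} t *\<^sub>R (2 * ln 2 - (ln 2 - ln \<bar>cos (pi * t)\<bar>))"
      using AE_cos_neq[of 0] by eventually_elim (simp add: ln_mult)
  qed measurable
  also have "\<dots> = (LBINT t:{0..1::real}. 2 * ln 2) - (LBINT t:{0..1}. ln 2 - ln \<bar>cos (pi * t)\<bar>)"
    by (rule set_integral_diff(2)[OF const int])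
  also have "(LBINT t:{0..1::real}. 2 * ln 2) = 2 * ln (2::real)"
    by (simp add: set_lebesgue_integral_def)
  finally have "(LBINT t:{0..1}. ln 2 - ln \<bar>cos (pi * t)\<bar>) = 2 * ln 2"
    unfolding set_lebesgue_integral_ln_cos by linarith
  then have "(\<integral>t. ?f t \<partial>lborel) = ln 4"
    using ln_realpow[of 2 2] by (simp add: set_lebesgue_integral_def)
  moreover have "(\<integral>\<^sup>+t. ennreal (?f t) \<partial>lborel) = ennreal (\<integral>t. ?f t \<partial>lborel)"
  proof (rule nn_integral_eq_integral)
    show "integrable lborel ?f" using int by (simp only: set_integrable_def)
    have "0 \<le> ln 2 - ln \<bar>cos (pi * t)\<bar>" for t
      using ln_cos[of "pi * t"] ln_ge_zero[of 2] by linarith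
    then show "AE t in lborel. 0 \<le> ?f t" by simp
  qed
  moreover have "(\<integral>\<^sup>+t\<in>{0..1}. ennreal (ln 2 - ln \<bar>cos (pi * t)\<bar>) \<partial>lborel) = (\<integral>\<^sup>+t. ennreal (?f t) \<partial>lborel)"
    by (rule nn_integral_cong) (auto simp: indicator_def)
  ultimately show ?thesis by simp
qed

text \<open>The layer cake \<open>ln\<^sup>+ (v C / D) = \<integral> [D < v u] [u < C] / u\<close>, integrated over the two angles.\<close>

lemma nn_integral_log_plus_ratio:
  assumes v: "0 \<le> v" "v \<le> 1"
  shows "(\<integral>\<^sup>+a\<in>{0..1}. (\<integral>\<^sup>+c\<in>{0..1}. ennreal (ln (max (v * \<bar>cos (pi * a)\<bar>) \<bar>cos (pi * c)\<bar>) - ln \<bar>cos (pi * c)\<bar>)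
      \<partial>lborel) \<partial>lborel) = ennreal (4 / pi\<^sup>2 * legendre_chi3 v)"
proof -
  \<comment> \<open>Each angle receives its own indicator, so that for fixed \<open>u\<close> the
    double integral over the angles splits into a product of two arcsine laws.\<close>
  define p :: "real \<Rightarrow> real \<Rightarrow> ennreal" where "p a u = (if u < \<bar>cos (pi * a)\<bar> then 1 else 0) * indicator {0..1} a" for a u
  define q :: "real \<Rightarrow> real \<Rightarrow> ennreal" where "q c u = (if \<bar>cos (pi * c)\<bar> < v * u then 1 else 0) * indicator {0..1} c" for c u
  define w :: "real \<Rightarrow> ennreal" where "w u = ennreal (1 / u) * indicator {0<..<1} u" for u
  have [measurable]: "case_prod p \<in> borel_measurable (borel \<Otimes>\<^sub>M borel)" "case_prod q \<in> borel_measurable (borel \<Otimes>\<^sub>M borel)"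
    "w \<in> borel_measurable borel"
    unfolding p_def q_def w_def by measurable
  have layer: "ennreal (ln (max (v * \<bar>cos (pi * a)\<bar>) \<bar>cos (pi * c)\<bar>) - ln \<bar>cos (pi * c)\<bar>) * indicator {0..1} c * indicator {0..1} a
      = (\<integral>\<^sup>+u. w u * (p a u * q c u) \<partial>lborel)" if "cos (pi * c) \<noteq> 0" for a c
  proof -
    have "ennreal (ln (max (v * \<bar>cos (pi * a)\<bar>) \<bar>cos (pi * c)\<bar>) - ln \<bar>cos (pi * c)\<bar>)
      = (\<integral>\<^sup>+u\<in>{0<..<1}. ennreal (1 / u) * ((if \<bar>cos (pi * c)\<bar> < v * u then 1 else 0) * (if u < \<bar>cos (pi * a)\<bar> then 1 else 0)) \<partial>lborel)"
      using that v by (intro nn_integral_layer[symmetric]) auto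
    then show ?thesis
      by (auto simp: p_def q_def w_def indicator_def intro!: nn_integral_cong)
  qed
  have "(\<integral>\<^sup>+a\<in>{0..1}. (\<integral>\<^sup>+c\<in>{0..1}. ennreal (ln (max (v * \<bar>cos (pi * a)\<bar>) \<bar>cos (pi * c)\<bar>) - ln \<bar>cos (pi * c)\<bar>)
      \<partial>lborel) \<partial>lborel) = (\<integral>\<^sup>+a. (\<integral>\<^sup>+c. (\<integral>\<^sup>+u. w u * (p a u * q c u) \<partial>lborel) \<partial>lborel) \<partial>lborel)"
  proof (rule nn_integral_cong)
    fix a :: real
    have "(\<integral>\<^sup>+c\<in>{0..1}. ennreal (ln (max (v * \<bar>cos (pi * a)\<bar>) \<bar>cos (pi * c)\<bar>) - ln \<bar>cos (pi * c)\<bar>) \<partial>lborel) * indicator {0..1} a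
        = (\<integral>\<^sup>+c. ennreal (ln (max (v * \<bar>cos (pi * a)\<bar>) \<bar>cos (pi * c)\<bar>) - ln \<bar>cos (pi * c)\<bar>) * indicator {0..1} c * indicator {0..1} a \<partial>lborel)"
      by (rule nn_integral_multc[symmetric]) measurable
    also have "\<dots> = (\<integral>\<^sup>+c. (\<integral>\<^sup>+u. w u * (p a u * q c u) \<partial>lborel) \<partial>lborel)"
      by (rule nn_integral_cong_AE, use AE_cos_neq[of 0] in eventually_elim) (rule layer)
    finally show "(\<integral>\<^sup>+c\<in>{0..1}. ennreal (ln (max (v * \<bar>cos (pi * a)\<bar>) \<bar>cos (pi * c)\<bar>) - ln \<bar>cos (pi * c)\<bar>) \<partial>lborel) * indicator {0..1} a
      = (\<integral>\<^sup>+c. (\<integral>\<^sup>+u. w u * (p a u * q c u) \<partial>lborel) \<partial>lborel)" .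
  qed
  also have "\<dots> = (\<integral>\<^sup>+a. (\<integral>\<^sup>+u. (\<integral>\<^sup>+c. w u * (p a u * q c u) \<partial>lborel) \<partial>lborel) \<partial>lborel)"
    by (intro nn_integral_cong lborel_pair.Fubini') measurable
  also have "\<dots> = (\<integral>\<^sup>+u. (\<integral>\<^sup>+a. (\<integral>\<^sup>+c. w u * (p a u * q c u) \<partial>lborel) \<partial>lborel) \<partial>lborel)"
    by (rule lborel_pair.Fubini') measurable
  also have "\<dots> = (\<integral>\<^sup>+u. w u * ((\<integral>\<^sup>+a. p a u \<partial>lborel) * (\<integral>\<^sup>+c. q c u \<partial>lborel)) \<partial>lborel)"
    by (intro nn_integral_cong) (simp add: nn_integral_cmult nn_integral_multc)
  also have "\<dots> = (\<integral>\<^sup>+u. ennreal (4 / pi\<^sup>2) * (ennreal (arcsin (v * u) * arccos u / u) * indicator {0<..<1} u) \<partial>lborel)"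
  proof (rule nn_integral_cong)
    fix u :: real
    show "w u * ((\<integral>\<^sup>+a. p a u \<partial>lborel) * (\<integral>\<^sup>+c. q c u \<partial>lborel))
      = ennreal (4 / pi\<^sup>2) * (ennreal (arcsin (v * u) * arccos u / u) * indicator {0<..<1} u)"
    proof (cases "u \<in> {0<..<1}")
      case True
      have vu: "0 \<le> v * u" "v * u \<le> 1" using True v by (auto intro: mult_le_one)
      have nn: "0 \<le> 1 / u" "0 \<le> 2 / pi * arccos u" "0 \<le> 2 / pi * arcsin (v * u)"
        using True vu by (auto simp: arccos_lbound arcsin_nonneg)
      have "w u * ((\<integral>\<^sup>+a. p a u \<partial>lborel) * (\<integral>\<^sup>+c. q c u \<partial>lborel))
        = ennreal (1 / u) * (ennreal (2 / pi * arccos u) * ennreal (2 / pi * arcsin (v * u)))"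
        using True nn_integral_cos_greater[of u] nn_integral_cos_less[OF vu] by (simp add: w_def p_def q_def)
      also have "\<dots> = ennreal (1 / u * (2 / pi * arccos u * (2 / pi * arcsin (v * u))))"
        using nn by (simp only: ennreal_mult[symmetric] mult_nonneg_nonneg)
      also have "1 / u * (2 / pi * arccos u * (2 / pi * arcsin (v * u))) = 4 / pi\<^sup>2 * (arcsin (v * u) * arccos u / u)"
        by (simp add: power2_eq_square mult_ac)
      also have "ennreal \<dots> = ennreal (4 / pi\<^sup>2) * ennreal (arcsin (v * u) * arccos u / u)"
        by (rule ennreal_mult') simp
      finally show ?thesis using True by simp
    next
      case False
      then show ?thesis by (simp add: w_def)
    qed
  qed
  also have "\<dots> = ennreal (4 / pi\<^sup>2) * ennreal (legendre_chi3 v)"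
    by (subst nn_integral_cmult) (simp_all add: nn_integral_arcsin_arccos[OF v] borel_measurable_arcsin_arccos[OF v])
  also have "\<dots> = ennreal (4 / pi\<^sup>2 * legendre_chi3 v)"
    by (rule ennreal_mult'[symmetric]) simp
  finally show ?thesis .
qed

text \<open>This integral and the one of \<open>nn_integral_log_plus_ratio\<close> add up to
  \<open>ln 4\<close>, and the finite summand is cancelled in \<open>ennreal\<close>. The inequality
  makes the difference nonnegative, so that \<open>ennreal\<close> does not truncate it.\<close>

lemma nn_integral_log_max:
  assumes v: "0 \<le> v" "v \<le> 1"
  shows "(\<integral>\<^sup>+a\<in>{0..1}. (\<integral>\<^sup>+c\<in>{0..1}. ennreal (ln 2 - ln (max (v * \<bar>cos (pi * a)\<bar>) \<bar>cos (pi * c)\<bar>))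
      \<partial>lborel) \<partial>lborel) = ennreal (ln 4 - 4 / pi\<^sup>2 * legendre_chi3 v)"
    and "4 / pi\<^sup>2 * legendre_chi3 v \<le> ln 4"
proof -
  let ?m = "\<lambda>a c. max (v * \<bar>cos (pi * a)\<bar>) \<bar>cos (pi * c)\<bar>"
  let ?T = "\<integral>\<^sup>+a\<in>{0..1}. (\<integral>\<^sup>+c\<in>{0..1}. ennreal (ln 2 - ln (?m a c)) \<partial>lborel) \<partial>lborel"
  let ?L = "\<integral>\<^sup>+a\<in>{0..1}. (\<integral>\<^sup>+c\<in>{0..1}. ennreal (ln (?m a c) - ln \<bar>cos (pi * c)\<bar>) \<partial>lborel) \<partial>lborel"
  have chi: "0 \<le> legendre_chi3 v" by (rule legendre_chi3_nonneg[OF v])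
  have inner: "(\<integral>\<^sup>+c\<in>{0..1}. ennreal (ln 2 - ln (?m a c)) \<partial>lborel)
      + (\<integral>\<^sup>+c\<in>{0..1}. ennreal (ln (?m a c) - ln \<bar>cos (pi * c)\<bar>) \<partial>lborel) = ennreal (ln 4)" for a
  proof -
    have "(\<integral>\<^sup>+c\<in>{0..1}. ennreal (ln 2 - ln (?m a c)) \<partial>lborel)
        + (\<integral>\<^sup>+c\<in>{0..1}. ennreal (ln (?m a c) - ln \<bar>cos (pi * c)\<bar>) \<partial>lborel)
      = (\<integral>\<^sup>+c. ennreal (ln 2 - ln (?m a c)) * indicator {0..1} c
          + ennreal (ln (?m a c) - ln \<bar>cos (pi * c)\<bar>) * indicator {0..1} c \<partial>lborel)"
      by (rule nn_integral_add[symmetric]) measurable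
    also have "\<dots> = (\<integral>\<^sup>+c\<in>{0..1}. ennreal (ln 2 - ln \<bar>cos (pi * c)\<bar>) \<partial>lborel)"
    proof (rule nn_integral_cong_AE, use AE_cos_neq[of 0] in eventually_elim)
      fix c :: real assume c: "cos (pi * c) \<noteq> 0"
      have pos: "0 < ?m a c" using c by (simp add: less_max_iff_disj)
      have "?m a c \<le> 1" using v by (auto intro!: mult_le_one)
      then have "ln (?m a c) \<le> ln 2" using pos by (subst ln_le_cancel_iff) linarith+
      moreover have "ln \<bar>cos (pi * c)\<bar> \<le> ln (?m a c)" using pos c by (subst ln_le_cancel_iff) auto
      ultimately have "ennreal (ln 2 - ln (?m a c)) + ennreal (ln (?m a c) - ln \<bar>cos (pi * c)\<bar>)
          = ennreal (ln 2 - ln \<bar>cos (pi * c)\<bar>)"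
        by (subst ennreal_plus[symmetric]) auto
      then show "ennreal (ln 2 - ln (?m a c)) * indicator {0..1} c
          + ennreal (ln (?m a c) - ln \<bar>cos (pi * c)\<bar>) * indicator {0..1} c
        = ennreal (ln 2 - ln \<bar>cos (pi * c)\<bar>) * indicator {0..1} c"
        by (simp add: distrib_right[symmetric])
    qed
    finally show ?thesis by (simp only: nn_integral_ln_two_cos)
  qed
  have "?T + ?L = (\<integral>\<^sup>+a. (\<integral>\<^sup>+c\<in>{0..1}. ennreal (ln 2 - ln (?m a c)) \<partial>lborel) * indicator {0..1} a
      + (\<integral>\<^sup>+c\<in>{0..1}. ennreal (ln (?m a c) - ln \<bar>cos (pi * c)\<bar>) \<partial>lborel) * indicator {0..1} a \<partial>lborel)"
    by (rule nn_integral_add[symmetric]) measurable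
  also have "\<dots> = (\<integral>\<^sup>+a. ennreal (ln 4) * indicator {0..1::real} a \<partial>lborel)"
    by (simp only: distrib_right[symmetric] inner)
  also have "\<dots> = ennreal (ln 4)"
    by (simp add: nn_integral_cmult_indicator)
  finally have sum: "?T + ennreal (4 / pi\<^sup>2 * legendre_chi3 v) = ennreal (ln 4)"
    by (simp only: nn_integral_log_plus_ratio[OF v])
  have "ennreal (4 / pi\<^sup>2 * legendre_chi3 v) \<le> ?T + ennreal (4 / pi\<^sup>2 * legendre_chi3 v)"
    by (rule add_increasing[OF zero_le order_refl])
  then have "ennreal (4 / pi\<^sup>2 * legendre_chi3 v) \<le> ennreal (ln 4)"
    unfolding sum .
  then show le: "4 / pi\<^sup>2 * legendre_chi3 v \<le> ln 4"
    by (subst (asm) ennreal_le_iff) auto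
  have "ennreal (4 / pi\<^sup>2 * legendre_chi3 v) + ?T
      = ennreal (4 / pi\<^sup>2 * legendre_chi3 v) + ennreal (ln 4 - 4 / pi\<^sup>2 * legendre_chi3 v)"
    unfolding add.commute[of _ ?T] sum by (subst ennreal_plus[symmetric]) (use le chi in auto)
  then show "?T = ennreal (ln 4 - 4 / pi\<^sup>2 * legendre_chi3 v)"
    by (simp add: ennreal_add_left_cancel)
qed

section \<open>Reduction of the integral over three angles to the maximum\<close>

lemma cmod_linear_form_le:
  assumes "0 \<le> v" "v \<le> 1"
  shows "ln (cmod (of_real v * (1 + cis x) + cis y + cis z)) \<le> ln 4"
proof -
  let ?P = "of_real v * (1 + cis x) + cis y + cis z"
  have "cmod (1 + cis x) \<le> 2"
    using norm_triangle_ineq[of 1 "cis x"] by simp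
  then have "cmod (of_real v * (1 + cis x)) \<le> 2"
    using assms mult_mono[of v 1 "cmod (1 + cis x)" 2] by (simp add: norm_mult)
  moreover have "cmod ?P \<le> cmod (of_real v * (1 + cis x)) + cmod (cis y) + cmod (cis z)"
    by (intro order_trans[OF norm_triangle_ineq] add_mono norm_triangle_ineq order_refl)
  ultimately have "cmod ?P \<le> 4" by simp
  then show ?thesis
    \<comment> \<open>At a zero of the form the convention \<open>ln 0 = 0\<close> still respects
      the bound.\<close>
    by (cases "?P = 0") (auto simp: ln_le_cancel_iff)
qed

lemma nn_integral_linear_form:
  assumes v: "0 \<le> v" "v \<le> 1"
  defines "e \<equiv> \<lambda>t::real. cis (2 * pi * t)"
  shows "(\<integral>\<^sup>+a\<in>{0..1}. (\<integral>\<^sup>+b\<in>{0..1}. (\<integral>\<^sup>+c\<in>{0..1}.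
      ennreal (ln 4 - ln (cmod (of_real v * (1 + e a) + e b + e c))) \<partial>lborel) \<partial>lborel) \<partial>lborel)
    = ennreal (ln 4 - 4 / pi\<^sup>2 * legendre_chi3 v)"
proof -
  have e_meas [measurable]: "e \<in> borel_measurable borel"
    unfolding e_def by (intro borel_measurable_continuous_onI continuous_intros)
  have e1: "e (t + 1) = e t" for t
    by (simp add: e_def distrib_left cis_mult[symmetric])
  have e_add: "e (b + c) = e b * e c" for b c
    by (simp add: e_def distrib_left cis_mult[symmetric])
  have norm_e: "cmod (1 + e t) = 2 * \<bar>cos (pi * t)\<bar>" for t
    using cmod_one_plus_cis[of "pi * t"] by (simp add: e_def mult.assoc)
  \<comment> \<open>Periodicity allows replacing \<open>c\<close> by \<open>b + c\<close>, after
    which \<open>e b\<close> factors out of the last two terms.\<close>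
  have rotate: "(\<integral>\<^sup>+c\<in>{0..1}. ennreal (ln 4 - ln (cmod (A + e b + e c))) \<partial>lborel)
      = (\<integral>\<^sup>+c\<in>{0..1}. ennreal (ln 4 - ln (cmod (A + (1 + e c) * e b))) \<partial>lborel)" if "b \<in> {0..1}" for A b
  proof -
    have "(\<integral>\<^sup>+c\<in>{0..1}. ennreal (ln 4 - ln (cmod (A + e b + e c))) \<partial>lborel)
        = (\<integral>\<^sup>+c\<in>{0..1}. ennreal (ln 4 - ln (cmod (A + e b + e (b + c)))) \<partial>lborel)"
      using that by (intro nn_integral_periodic_shift[symmetric]) (auto simp: e1)
    then show ?thesis by (simp add: e_add algebra_simps)
  qed
  have jensen: "(\<integral>\<^sup>+b\<in>{0..1}. ennreal (ln 4 - ln (cmod (of_real v * (1 + e a) + (1 + e c) * e b))) \<partial>lborel)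
      = ennreal (ln 2 - ln (max (v * \<bar>cos (pi * a)\<bar>) \<bar>cos (pi * c)\<bar>))"
    if c: "cos (pi * c) \<noteq> 0" and ne: "v * \<bar>cos (pi * a)\<bar> \<noteq> \<bar>cos (pi * c)\<bar>" for a c
  proof -
    have n: "cmod (of_real v * (1 + e a)) = 2 * (v * \<bar>cos (pi * a)\<bar>)"
      using v by (simp add: norm_mult norm_e)
    have ineq: "0 \<le> ln 4 - ln (cmod (of_real v * (1 + e a) + (1 + e c) * e b))" for b
    proof -
      have "ln (cmod (of_real v * (1 + e a) + e b + e (b + c))) \<le> ln 4"
        unfolding e_def by (rule cmod_linear_form_le[OF v])
      then show ?thesis by (simp add: e_add algebra_simps)
    qed
    have "((\<lambda>b. ln (cmod (of_real v * (1 + e a) + (1 + e c) * e b))) has_integral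
        ln (max (2 * (v * \<bar>cos (pi * a)\<bar>)) (2 * \<bar>cos (pi * c)\<bar>))) {0..1}"
      using jensen_linear[of "of_real v * (1 + e a)" "1 + e c"] ne n norm_e[of c] by (simp add: e_def)
    then have "((\<lambda>b. ln 4 - ln (cmod (of_real v * (1 + e a) + (1 + e c) * e b))) has_integral
        ln 4 - ln (max (2 * (v * \<bar>cos (pi * a)\<bar>)) (2 * \<bar>cos (pi * c)\<bar>))) {0..1}"
      using has_integral_diff[OF has_integral_const_real[of "ln 4" 0 1]] by simp
    then have "(\<integral>\<^sup>+b\<in>{0..1}. ennreal (ln 4 - ln (cmod (of_real v * (1 + e a) + (1 + e c) * e b))) \<partial>lborel)
        = ennreal (ln 4 - ln (max (2 * (v * \<bar>cos (pi * a)\<bar>)) (2 * \<bar>cos (pi * c)\<bar>)))"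
      by (rule nn_integral_has_integral_lebesgue'[rotated]) (rule ineq)
    also have "max (2 * (v * \<bar>cos (pi * a)\<bar>)) (2 * \<bar>cos (pi * c)\<bar>) = 2 * max (v * \<bar>cos (pi * a)\<bar>) \<bar>cos (pi * c)\<bar>"
      by (simp add: max_def)
    also have "ln 4 - ln (2 * max (v * \<bar>cos (pi * a)\<bar>) \<bar>cos (pi * c)\<bar>)
        = ln 2 - ln (max (v * \<bar>cos (pi * a)\<bar>) \<bar>cos (pi * c)\<bar>)"
    proof -
      have "0 < max (v * \<bar>cos (pi * a)\<bar>) \<bar>cos (pi * c)\<bar>"
        using c by (simp add: less_max_iff_disj)
      then show ?thesis using ln_realpow[of 2 2] by (simp add: ln_mult)
    qed
    finally show ?thesis .
  qed
  have "(\<integral>\<^sup>+b\<in>{0..1}. (\<integral>\<^sup>+c\<in>{0..1}. ennreal (ln 4 - ln (cmod (of_real v * (1 + e a) + e b + e c))) \<partial>lborel) \<partial>lborel)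
      = (\<integral>\<^sup>+c\<in>{0..1}. ennreal (ln 2 - ln (max (v * \<bar>cos (pi * a)\<bar>) \<bar>cos (pi * c)\<bar>)) \<partial>lborel)" for a
  proof -
    let ?g = "\<lambda>b c. ennreal (ln 4 - ln (cmod (of_real v * (1 + e a) + (1 + e c) * e b)))"
    have "(\<integral>\<^sup>+b\<in>{0..1}. (\<integral>\<^sup>+c\<in>{0..1}. ennreal (ln 4 - ln (cmod (of_real v * (1 + e a) + e b + e c))) \<partial>lborel) \<partial>lborel)
        = (\<integral>\<^sup>+b\<in>{0..1}. (\<integral>\<^sup>+c\<in>{0..1}. ?g b c \<partial>lborel) \<partial>lborel)"
    proof (rule nn_integral_cong)
      fix b :: real
      show "(\<integral>\<^sup>+c\<in>{0..1}. ennreal (ln 4 - ln (cmod (of_real v * (1 + e a) + e b + e c))) \<partial>lborel) * indicator {0..1} b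
          = (\<integral>\<^sup>+c\<in>{0..1}. ?g b c \<partial>lborel) * indicator {0..1} b"
        by (cases "b \<in> {0..1}") (simp_all only: rotate, simp)
    qed
    \<comment> \<open>The order is exchanged because Jensen's formula integrates over
      \<open>b\<close> with \<open>a\<close> and \<open>c\<close> fixed.\<close>
    also have "\<dots> = (\<integral>\<^sup>+b. (\<integral>\<^sup>+c. ?g b c * indicator {0..1} c * indicator {0..1} b \<partial>lborel) \<partial>lborel)"
      by (intro nn_integral_cong nn_integral_multc[symmetric]) measurable
    also have "\<dots> = (\<integral>\<^sup>+c. (\<integral>\<^sup>+b. ?g b c * indicator {0..1} c * indicator {0..1} b \<partial>lborel) \<partial>lborel)"
      by (rule lborel_pair.Fubini') measurable
    also have "\<dots> = (\<integral>\<^sup>+c\<in>{0..1}. (\<integral>\<^sup>+b\<in>{0..1}. ?g b c \<partial>lborel) \<partial>lborel)"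
      by (intro nn_integral_cong) (auto simp: indicator_def)
    also have "\<dots> = (\<integral>\<^sup>+c\<in>{0..1}. ennreal (ln 2 - ln (max (v * \<bar>cos (pi * a)\<bar>) \<bar>cos (pi * c)\<bar>)) \<partial>lborel)"
    \<comment> \<open>For fixed \<open>a\<close>, ties of the two moduli force the cosine at
      \<open>c\<close> to take one of two values, a null condition on \<open>c\<close>.\<close>
    proof (rule nn_integral_cong_AE, use AE_cos_neq[of 0] AE_cos_neq[of "v * \<bar>cos (pi * a)\<bar>"] AE_cos_neq[of "- (v * \<bar>cos (pi * a)\<bar>)"] in eventually_elim)
      fix c :: real
      assume c: "cos (pi * c) \<noteq> 0" "cos (pi * c) \<noteq> v * \<bar>cos (pi * a)\<bar>" "cos (pi * c) \<noteq> - (v * \<bar>cos (pi * a)\<bar>)"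
      then have "v * \<bar>cos (pi * a)\<bar> \<noteq> \<bar>cos (pi * c)\<bar>"
        by (auto simp: abs_if split: if_splits)
      with c show "(\<integral>\<^sup>+b\<in>{0..1}. ?g b c \<partial>lborel) * indicator {0..1} c
          = ennreal (ln 2 - ln (max (v * \<bar>cos (pi * a)\<bar>) \<bar>cos (pi * c)\<bar>)) * indicator {0..1} c"
        by (subst jensen) auto
    qed
    finally show ?thesis .
  qed
  then show ?thesis
    by (simp only: nn_integral_log_max(1)[OF v])
qed

text \<open>The finite nonnegative integral of \<open>ln 4 - F\<close> yields Bochner integrability
  together with the value. Subtracting it from the constant \<open>ln 4\<close> on a cube of volume
  1 gives the integral of \<open>F\<close>.\<close>

lemma mahler_measure_linear_form:
  assumes v: "0 \<le> v" "v \<le> 1"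
  shows "mahler_measure
      (laurent_const (of_real v) * (1 + laurent_var 1) + laurent_var 2 + laurent_var 3 :: 3 laurent)
    = 4 / pi\<^sup>2 * legendre_chi3 v"
proof -
  let ?k = "4 / pi\<^sup>2 * legendre_chi3 v"
  define F :: "real ^ 3 \<Rightarrow> real" where "F x = ln (cmod (of_real v * (1 + cis (2 * pi * x $ 1)) + cis (2 * pi * x $ 2) + cis (2 * pi * x $ 3)))" for x
  define B :: "(real ^ 3) set" where "B = cbox 0 1"
  have cis_meas: "(\<lambda>x. cis (2 * pi * x $ i)) \<in> borel_measurable (borel :: (real ^ 3) measure)" for i
    by (intro borel_measurable_continuous_onI continuous_intros)
  have [measurable]: "F \<in> borel_measurable borel"
    unfolding F_def using cis_meas by measurable
  have [measurable]: "B \<in> sets borel" by (simp add: B_def)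
  have F: "F x \<le> ln 4" for x
    unfolding F_def by (rule cmod_linear_form_le[OF v])
  have ind: "indicator B (vector [a, b, c]) = (indicator {0..1} c * indicator {0..1} b * indicator {0..1} a :: ennreal)" for a b c
    by (auto simp: B_def mem_box_cart forall_3 indicator_def)
  have "(\<integral>\<^sup>+x. ennreal (ln 4 - F x) * indicator B x \<partial>lborel)
      = (\<integral>\<^sup>+a. (\<integral>\<^sup>+b. (\<integral>\<^sup>+c. ennreal (ln 4 - F (vector [a, b, c])) * indicator B (vector [a, b, c]) \<partial>lborel) \<partial>lborel) \<partial>lborel)"
    by (rule nn_integral_vec3) measurable
  also have "\<dots> = (\<integral>\<^sup>+a\<in>{0..1}. (\<integral>\<^sup>+b\<in>{0..1}. (\<integral>\<^sup>+c\<in>{0..1}. ennreal (ln 4 - F (vector [a, b, c])) \<partial>lborel) \<partial>lborel) \<partial>lborel)"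
    unfolding ind
  proof (intro nn_integral_cong)
    fix a :: real
    show "(\<integral>\<^sup>+b. (\<integral>\<^sup>+c. ennreal (ln 4 - F (vector [a, b, c])) * (indicator {0..1} c * indicator {0..1} b * indicator {0..1} a) \<partial>lborel) \<partial>lborel)
      = (\<integral>\<^sup>+b\<in>{0..1}. (\<integral>\<^sup>+c\<in>{0..1}. ennreal (ln 4 - F (vector [a, b, c])) \<partial>lborel) \<partial>lborel) * indicator {0..1} a"
      by (cases "a \<in> {0..1}") (auto intro!: nn_integral_cong simp: indicator_def)
  qed
  also have "\<dots> = ennreal (ln 4 - ?k)"
    using nn_integral_linear_form[OF v] by (simp add: F_def)
  finally have nn: "(\<integral>\<^sup>+x. ennreal (indicator B x *\<^sub>R (ln 4 - F x)) \<partial>lborel) = ennreal (ln 4 - ?k)"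
  proof (rule trans[rotated])
    show "(\<integral>\<^sup>+x. ennreal (indicator B x *\<^sub>R (ln 4 - F x)) \<partial>lborel) = (\<integral>\<^sup>+x. ennreal (ln 4 - F x) * indicator B x \<partial>lborel)"
      by (rule nn_integral_cong) (auto simp: indicator_def)
  qed
  have hbi: "has_bochner_integral lborel (\<lambda>x. indicator B x *\<^sub>R (ln 4 - F x)) (ln 4 - ?k)"
    by (rule has_bochner_integral_nn_integral) (use F nn nn_integral_log_max(2)[OF v] in \<open>auto simp: indicator_def\<close>)
  have basis: "1 \<bullet> b = 1" if "b \<in> Basis" for b :: "real ^ 3"
    using that by (auto simp: Basis_vec_def inner_axis)
  have "emeasure lborel B = ennreal (\<Prod>b\<in>Basis. (1 - 0 :: real ^ 3) \<bullet> b)"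
    unfolding B_def by (rule emeasure_lborel_cbox) (simp add: basis)
  then have "emeasure lborel B = 1"
    by (simp add: basis)
  then have "has_bochner_integral lborel (\<lambda>x. indicator B x *\<^sub>R ln 4) (ln (4::real))"
    by (auto simp: has_bochner_integral_iff measure_def)
  from has_bochner_integral_diff[OF this hbi]
  have "has_bochner_integral lborel (\<lambda>x. indicator B x *\<^sub>R F x) ?k"
    by (simp add: algebra_simps)
  then have "(LBINT x:B. F x) = ?k"
    by (simp add: set_lebesgue_integral_def has_bochner_integral_iff)
  then show ?thesis
    unfolding mahler_measure_def laurent_eval_linear_form B_def F_def
    by (simp add: cis_conv_exp mult_ac)
qed

section \<open>The one-dimensional arcsine integrals\<close>

lemma set_integrable_bounded_continuous:
  fixes f :: "real \<Rightarrow> real"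
  assumes "continuous_on {a<..<b} f" and bound: "\<And>x. x \<in> {a<..<b} \<Longrightarrow> \<bar>f x\<bar> \<le> B"
  shows "set_integrable lborel {a<..<b} f"
  unfolding set_integrable_def
proof (rule integrableI_bounded_set)
  have "(\<lambda>x. indicator {a<..<b} x *\<^sub>R f x) \<in> borel_measurable borel"
    by (rule borel_measurable_continuous_on_indicator) (use assms in auto)
  then show "(\<lambda>x. indicator {a<..<b} x *\<^sub>R f x) \<in> borel_measurable lborel"
    by simp
  show "emeasure lborel {a<..<b} < \<infinity>"
    by (cases "a \<le> b") auto
  show "AE x in lborel. x \<in> {a<..<b} \<longrightarrow> norm (indicator {a<..<b} x *\<^sub>R f x) \<le> B"
    using bound by (intro AE_I2) auto
qed auto

text \<open>The substitution of \<open>v * u\<close> for \<open>u\<close> leaves du/u invariant. It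
  degenerates at \<open>v = 0\<close>, where both sides vanish.\<close>

lemma lborel_integral_arcsin_over_scale:
  assumes "0 \<le> v"
  shows "(LBINT u=0..v. arcsin u / u) = (LBINT u:{0<..<1}. arcsin (v * u) / u)"
proof (cases "v = 0")
  case False
  then have v: "0 < v" using assms by simp
  have "(LBINT u=0..v. arcsin u / u) = (\<integral>u. indicator {0<..<v} u *\<^sub>R (arcsin u / u) \<partial>lborel)"
    using assms by (subst interval_integral_Ioo) (auto simp: set_lebesgue_integral_def)
  also have "\<dots> = \<bar>v\<bar> *\<^sub>R (\<integral>u. indicator {0<..<v} (0 + v * u) *\<^sub>R (arcsin (0 + v * u) / (0 + v * u)) \<partial>lborel)"
    by (rule lborel_integral_real_affine) (use v in simp)
  also have "\<dots> = (\<integral>u. v * (indicator {0<..<v} (v * u) * (arcsin (v * u) / (v * u))) \<partial>lborel)"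
    by (simp only: integral_mult_right_zero real_scaleR_def abs_of_pos[OF v] add_0)
  also have "\<dots> = (\<integral>u. indicator {0<..<1} u *\<^sub>R (arcsin (v * u) / u) \<partial>lborel)"
    using v by (intro Bochner_Integration.integral_cong) (auto simp: indicator_def zero_less_mult_iff)
  finally show ?thesis by (simp add: set_lebesgue_integral_def)
qed (simp add: zero_ereal_def[symmetric])

text \<open>Writing arccos u = pi/2 - arcsin u splits the arcsin-arccos integral into the two
  integrals of the first formula; the bounds on \<open>arcsin\<close> make each part integrable
  separately.\<close>

lemma arcsin_integrals_eq_legendre_chi3:
  assumes v: "0 \<le> v" "v \<le> 1"
  shows "2 / pi * (LBINT u=0..v. arcsin u / u) - 4 / pi\<^sup>2 * S_fun v 1 = 4 / pi\<^sup>2 * legendre_chi3 v"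
proof -
  let ?I = "{0<..<1::real}"
  let ?f = "\<lambda>u. arcsin (v * u) / u" and ?g = "\<lambda>u. arcsin (v * u) * arcsin u / u"
    and ?h = "\<lambda>u. arcsin (v * u) * arccos u / u"
  have sub: "?I \<subseteq> {0..1}" by auto
  have cont: "continuous_on ?I (\<lambda>u. arcsin (v * u))" "continuous_on ?I arcsin"
    using continuous_on_subset[OF continuous_on_arcsin_mult[OF v] sub]
      continuous_on_subset[OF continuous_on_arcsin_mult[of 1] sub] by auto
  have bnd: "0 \<le> arcsin (v * u)" "arcsin (v * u) \<le> pi / 2 * u" "0 \<le> arcsin u" "arcsin u \<le> pi / 2"
    if "u \<in> ?I" for u
  proof -
    have le: "v * u \<le> 1 * u" by (rule mult_right_mono) (use that v in auto)
    have "u < 1" using that by simp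
    then have vu: "0 \<le> v * u" "v * u \<le> 1" using that v le by (simp, linarith)
    show "0 \<le> arcsin (v * u)" using vu by (intro arcsin_nonneg) auto
    have "arcsin (v * u) \<le> arcsin u"
      by (rule arcsin_le_arcsin) (use vu le that in auto)
    also have "\<dots> \<le> pi / 2 * u" using that by (intro arcsin_le_linear) auto
    finally show "arcsin (v * u) \<le> pi / 2 * u" .
    show "0 \<le> arcsin u" using that by (intro arcsin_nonneg) auto
    show "arcsin u \<le> pi / 2" using that by (intro arcsin_ubound) auto
  qed
  have f_bnd: "0 \<le> ?f u" "?f u \<le> pi / 2" if "u \<in> ?I" for u
    using bnd[OF that] that by (auto simp: field_simps)
  have f: "set_integrable lborel ?I ?f"
  proof (rule set_integrable_bounded_continuous)
    show "continuous_on ?I ?f" by (intro continuous_intros cont) auto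
    show "\<bar>?f u\<bar> \<le> pi / 2" if "u \<in> ?I" for u using f_bnd[OF that] by simp
  qed
  have g: "set_integrable lborel ?I ?g"
  proof (rule set_integrable_bounded_continuous)
    show "continuous_on ?I ?g" by (intro continuous_intros cont) auto
    fix u assume u: "u \<in> ?I"
    have "\<bar>?g u\<bar> = ?f u * arcsin u" using f_bnd[OF u] bnd[OF u] u by simp
    also have "\<dots> \<le> pi / 2 * (pi / 2)"
      using f_bnd[OF u] bnd[OF u] by (intro mult_mono) auto
    finally show "\<bar>?g u\<bar> \<le> pi / 2 * (pi / 2)" .
  qed
  have h_eq: "?h u = pi / 2 * ?f u - ?g u" if "u \<in> ?I" for u
  proof -
    have "arccos u = pi / 2 - arcsin u" using that by (intro arccos_arcsin_eq) auto
    show ?thesis unfolding \<open>arccos u = pi / 2 - arcsin u\<close>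
      by (simp add: right_diff_distrib diff_divide_distrib mult.commute)
  qed
  have f': "set_integrable lborel ?I (\<lambda>u. pi / 2 * ?f u)"
    using f by (rule set_integrable_mult_right)
  have h: "set_integrable lborel ?I ?h"
    using set_integral_diff(1)[OF f' g]
    by (subst set_integrable_cong[OF refl refl h_eq]) auto
  have h_val: "(LBINT u:?I. ?h u) = legendre_chi3 v"
  proof -
    have h_nn: "0 \<le> ?h u" if "u \<in> ?I" for u
      using bnd(1)[OF that] arccos_lbound[of u] that by simp
    have "(\<integral>\<^sup>+u. ennreal (indicator ?I u *\<^sub>R ?h u) \<partial>lborel) = ennreal (LBINT u:?I. ?h u)"
      unfolding set_lebesgue_integral_def
      by (rule nn_integral_eq_integral) (use h h_nn in \<open>auto simp: set_integrable_def indicator_def\<close>)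
    moreover have "(\<integral>\<^sup>+u. ennreal (indicator ?I u *\<^sub>R ?h u) \<partial>lborel) = (\<integral>\<^sup>+u\<in>?I. ennreal (?h u) \<partial>lborel)"
      by (rule nn_integral_cong) (auto simp: indicator_def)
    moreover have "0 \<le> (LBINT u:?I. ?h u)"
      unfolding set_lebesgue_integral_def by (rule integral_nonneg_AE) (use h_nn in \<open>auto simp: indicator_def\<close>)
    \<comment> \<open>Both values are nonnegative, so equality in \<open>ennreal\<close> descends to
      the reals.\<close>
    ultimately show ?thesis
      using nn_integral_arcsin_arccos[OF v] legendre_chi3_nonneg[OF v] by simp
  qed
  have "(LBINT u:?I. ?h u) = (LBINT u:?I. pi / 2 * ?f u - ?g u)"
    by (rule set_lebesgue_integral_cong) (use h_eq in auto)
  also have "\<dots> = pi / 2 * (LBINT u:?I. ?f u) - (LBINT u:?I. ?g u)"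
    by (simp only: set_integral_diff(2)[OF f' g] set_integral_mult_right)
  also have "(LBINT u:?I. ?f u) = (LBINT u=0..v. arcsin u / u)"
    by (rule lborel_integral_arcsin_over_scale[OF v(1), symmetric])
  also have "(LBINT u:?I. ?g u) = S_fun v 1"
    unfolding S_fun_def by (subst interval_integral_Ioo) auto
  finally have "legendre_chi3 v = pi / 2 * (LBINT u=0..v. arcsin u / u) - S_fun v 1"
    unfolding h_val .
  then show ?thesis
    by (simp add: right_diff_distrib power2_eq_square)
qed

theorem corollary5p3:
  fixes v :: real
  assumes "v \<in> {0..1}"
  shows "mahler_measure
           (laurent_const (of_real v) * (1 + laurent_var 1) + laurent_var 2 + laurent_var 3 :: 3 laurent)
         = 2 / pi * (LBINT u=0..v. arcsin u / u) - 4 / pi\<^sup>2 * S_fun v 1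
       \<and> 2 / pi * (LBINT u=0..v. arcsin u / u) - 4 / pi\<^sup>2 * S_fun v 1
         = 4 / pi\<^sup>2 * ((Li3 v - Li3 (- v)) / 2)"
  \<comment> \<open>All three expressions meet in
    \<open>4 / pi\<^sup>2 * legendre_chi3 v\<close>.\<close>
  using mahler_measure_linear_form[of v] arcsin_integrals_eq_legendre_chi3[of v]
    legendre_chi3_eq_Li3[of v] assms by simp

end
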